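(* Let $a,c,y\in\mathbb{R}$ satisfy $c<0<a$, $2c+a<0$, $c<-a-c<a$ and $y\in[c,-a-c]$, let $\sigma>0$, and let $w_1,w_2$, $\mathcal{K}$ and the processes $\{x_n(t)\}_{t\ge0}$, $n\ge1$, be as defined in the context. Define recursively $$\gamma_1(t):=|w_1(t)|+|w_2(t)|,\qquad \gamma_n(t):=\int_0^t|\mathcal{K}(t,s)|\Big(\sum_{j=1}^{n-1}\gamma_j(s)\gamma_{n-j}(s)\Big)ds\quad(n\ge2),\qquad t\ge0.$$ Then for any $T>0$ and $n\ge1$, $$\mathbb{P}\Big(|x_n(t)|\le\frac{\gamma_n(t)}{\sigma^n}\ \text{for all } t\in[0,T]\Big)\ \ge\ 1-\sigma\,2^{(n-2)^+}\sqrt{2/\pi}\,\Big(\|w_1\|_{L^2([0,T])}+\|w_2\|_{L^2([0,T])}\Big),$$ where $(n-2)^+:=\max\{n-2,0\}$.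
   Context: $\{B(t)\}_{t\ge0}$ is a one-dimensional standard Brownian motion on a complete probability space $(\Omega,\mathcal{F},\mathbb{P})$. Set $\mathcal{K}(t,s):=w_2(t)w_1(s)-w_1(t)w_2(s)$ (with $w_1,w_2$ defined below), and $$x_1(t):=\int_0^t\mathcal{K}(t,s)\,dB(s)=w_2(t)\int_0^tw_1(s)\,dB(s)-w_1(t)\int_0^tw_2(s)\,dB(s),$$ $$x_n(t):=\int_0^t\mathcal{K}(t,s)\Big(\sum_{j=1}^{n-1}x_j(s)x_{n-j}(s)\Big)ds,\quad n\ge2.$$ Equivalently, $x_1$ solves $\ddot x_1=2x_0x_1+\dot B$ and $x_n$ ($n\ge2$) solves $\ddot x_n=2x_0x_n+\sum_{j=1}^{n-1}x_jx_{n-j}$, all with zero initial position and velocity. Let $q:=\sqrt{\frac{2c+a}{c-a}}\in(0,1)$, $F(\gamma,q):=\int_0^\gamma\frac{d\alpha}{\sqrt{1-q^2\sin^2\alpha}}$, $i_y:=F\big(\arcsin\sqrt{\frac{c-y}{2c+a}},q\big)$, and let $\mathrm{sn},\mathrm{cn},\mathrm{dn}$ be the Jacobi elliptic functions (second argument = modulus $q$). Set $$x_0(t):=c-(a+2c)\,\mathrm{sn}^2\Big(\sqrt{\tfrac{a-c}{6}}\,t+i_y,q\Big).$$ Let $\mathcal{E}(t,q):=\int_0^t\mathrm{dn}^2(s,q)\,ds$ (Jacobi's Epsilon function) and $$u_1(t):=\mathrm{sn}(t,q)\,\mathrm{cn}(t,q)\,\mathrm{dn}(t,q),$$ $$u_2(t):=\alpha_0+\alpha_1\mathrm{cn}^2(t,q)+\alpha_2\mathrm{cn}^4(t,q)+\big(\beta_0t+\beta_1\mathcal{E}(t,q)\big)u_1(t),$$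 with $\alpha_0=-1+q^2$, $\alpha_1=-2q^6+3q^4-5q^2+2$, $\alpha_2=2q^2(q^4-q^2+1)$, $\beta_0=-q^4+3q^2-2$, $\beta_1=2(q^4-q^2+1)$. The functions $w_i(t):=\kappa_i\,u_i\big(\sqrt{\tfrac{a-c}{6}}\,t+i_y\big)$, $i=1,2$, where $\kappa_1,\kappa_2$ are fixed nonzero real constants chosen so that the Wronskian is normalized, $w_1\dot w_2-\dot w_1w_2=1$, are two linearly independent solutions of $\ddot w(t)-2x_0(t)w(t)=0$. *)

theory Defs
  imports "HOL-Probability.Probability"
begin

subsection \<open>Jacobi elliptic functions (second argument = modulus)\<close>

definition elliptic_F :: "real \<Rightarrow> real \<Rightarrow> real" where
  "elliptic_F \<gamma> q = (LBINT \<alpha>=0..ereal \<gamma>. 1 / sqrt (1 - q\<^sup>2 * (sin \<alpha>)\<^sup>2))"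

text \<open>The Jacobi amplitude is the inverse function of \<open>\<gamma> \<mapsto> F(\<gamma>, q)\<close>, which is a
  bijection of the real line for \<open>0 < q < 1\<close>.\<close>

definition jacobi_am :: "real \<Rightarrow> real \<Rightarrow> real" where
  "jacobi_am u q = (THE \<gamma>. elliptic_F \<gamma> q = u)"

definition jacobi_sn :: "real \<Rightarrow> real \<Rightarrow> real" where
  "jacobi_sn u q = sin (jacobi_am u q)"

definition jacobi_cn :: "real \<Rightarrow> real \<Rightarrow> real" where
  "jacobi_cn u q = cos (jacobi_am u q)"

definition jacobi_dn :: "real \<Rightarrow> real \<Rightarrow> real" where
  "jacobi_dn u q = sqrt (1 - q\<^sup>2 * (jacobi_sn u q)\<^sup>2)"

definition jacobi_Epsilon :: "real \<Rightarrow> real \<Rightarrow> real" where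
  "jacobi_Epsilon t q = (LBINT s=0..ereal t. (jacobi_dn s q)\<^sup>2)"


subsection \<open>The solutions \<open>w\<^sub>1\<close>, \<open>w\<^sub>2\<close> of the linearised equation\<close>

definition ell_modulus :: "real \<Rightarrow> real \<Rightarrow> real" where
  "ell_modulus a c = sqrt ((2 * c + a) / (c - a))"

definition ell_phase :: "real \<Rightarrow> real \<Rightarrow> real \<Rightarrow> real" where
  "ell_phase a c y = elliptic_F (arcsin (sqrt ((c - y) / (2 * c + a)))) (ell_modulus a c)"

definition u1 :: "real \<Rightarrow> real \<Rightarrow> real" where
  "u1 q t = jacobi_sn t q * jacobi_cn t q * jacobi_dn t q"

definition u2 :: "real \<Rightarrow> real \<Rightarrow> real" where
  "u2 q t =
     (let \<alpha>0 = - 1 + q^2;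
          \<alpha>1 = - 2 * q^6 + 3 * q^4 - 5 * q^2 + 2;
          \<alpha>2 = 2 * q^2 * (q^4 - q^2 + 1);
          \<beta>0 = - (q^4) + 3 * q^2 - 2;
          \<beta>1 = 2 * (q^4 - q^2 + 1)
      in \<alpha>0 + \<alpha>1 * (jacobi_cn t q)^2 + \<alpha>2 * (jacobi_cn t q)^4
           + (\<beta>0 * t + \<beta>1 * jacobi_Epsilon t q) * u1 q t)"

definition w_sol :: "real \<Rightarrow> real \<Rightarrow> real \<Rightarrow> real \<Rightarrow> (real \<Rightarrow> real \<Rightarrow> real) \<Rightarrow> real \<Rightarrow> real" where
  "w_sol a c y \<kappa> u t =
     \<kappa> * u (ell_modulus a c) (sqrt ((a - c) / 6) * t + ell_phase a c y)"


subsection \<open>Brownian motion and the Wiener integral\<close>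

text \<open>Processes are indexed by all reals; only the times \<open>t \<ge> 0\<close> are constrained.\<close>

definition std_brownian_motion :: "'a measure \<Rightarrow> (real \<Rightarrow> 'a \<Rightarrow> real) \<Rightarrow> bool" where
  "std_brownian_motion M B \<longleftrightarrow>
     prob_space M \<and>
     (\<forall>t\<ge>0. B t \<in> borel_measurable M) \<and>
     (AE \<omega> in M. B 0 \<omega> = 0) \<and>
     (\<forall>s t. 0 \<le> s \<longrightarrow> s < t \<longrightarrow>
        distributed M lborel (\<lambda>\<omega>. B t \<omega> - B s \<omega>) (normal_density 0 (sqrt (t - s)))) \<and>
     (\<forall>(N::nat) (p::nat \<Rightarrow> real). 0 \<le> p 0 \<longrightarrow> (\<forall>i<N. p i < p (Suc i)) \<longrightarrow>
        prob_space.indep_vars M (\<lambda>_. borel) (\<lambda>i \<omega>. B (p (Suc i)) \<omega> - B (p i) \<omega>) {..<N}) \<and>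
     (AE \<omega> in M. continuous_on {0..} (\<lambda>t. B t \<omega>))"

definition L2_tendsto :: "'b measure \<Rightarrow> (nat \<Rightarrow> 'b \<Rightarrow> real) \<Rightarrow> ('b \<Rightarrow> real) \<Rightarrow> bool" where
  "L2_tendsto M X Y \<longleftrightarrow>
     (\<forall>k. X k \<in> borel_measurable M \<and> integrable M (\<lambda>z. (X k z)\<^sup>2)) \<and>
     Y \<in> borel_measurable M \<and> integrable M (\<lambda>z. (Y z)\<^sup>2) \<and>
     (\<lambda>k. \<integral>z. (X k z - Y z)\<^sup>2 \<partial>M) \<longlonglongrightarrow> 0"

text \<open>A step function is given by its partition points \<open>p 0 < \<dots> < p N\<close> and by the values \<open>v i\<close>
  on the intervals \<open>(p i, p (i + 1)]\<close>.\<close>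

definition step_fun :: "nat \<Rightarrow> (nat \<Rightarrow> real) \<Rightarrow> (nat \<Rightarrow> real) \<Rightarrow> real \<Rightarrow> real" where
  "step_fun N p v s = (\<Sum>i<N. v i * indicator {p i<..p (Suc i)} s)"

definition step_integral ::
    "(real \<Rightarrow> 'a \<Rightarrow> real) \<Rightarrow> nat \<Rightarrow> (nat \<Rightarrow> real) \<Rightarrow> (nat \<Rightarrow> real) \<Rightarrow> 'a \<Rightarrow> real" where
  "step_integral B N p v \<omega> = (\<Sum>i<N. v i * (B (p (Suc i)) \<omega> - B (p i) \<omega>))"

text \<open>\<open>I\<close> is a random variable representing the stochastic integral of the deterministic
  integrand \<open>f\<close> over \<open>[0, t]\<close>: the mean-square limit of the integrals of step functions
  converging to \<open>f\<close> in \<open>L\<^sup>2([0, t])\<close>.  By the Ito isometry the limit does not depend, up to null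
  sets, on the approximating sequence.\<close>

definition is_wiener_integral ::
    "'a measure \<Rightarrow> (real \<Rightarrow> 'a \<Rightarrow> real) \<Rightarrow> (real \<Rightarrow> real) \<Rightarrow> real \<Rightarrow> ('a \<Rightarrow> real) \<Rightarrow> bool" where
  "is_wiener_integral M B f t I \<longleftrightarrow>
     (\<exists>(N :: nat \<Rightarrow> nat) (p :: nat \<Rightarrow> nat \<Rightarrow> real) (v :: nat \<Rightarrow> nat \<Rightarrow> real).
        (\<forall>k. p k 0 = 0 \<and> p k (N k) = t \<and> (\<forall>i<N k. p k i < p k (Suc i))) \<and>
        L2_tendsto (restrict_space lborel {0..t}) (\<lambda>k. step_fun (N k) (p k) (v k)) f \<and>
        L2_tendsto M (\<lambda>k. step_integral B (N k) (p k) (v k)) I)"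

text \<open>As usual, the integral process is taken in a version with almost surely continuous paths.\<close>

definition wiener_integral_process ::
    "'a measure \<Rightarrow> (real \<Rightarrow> 'a \<Rightarrow> real) \<Rightarrow> (real \<Rightarrow> real) \<Rightarrow> (real \<Rightarrow> 'a \<Rightarrow> real) \<Rightarrow> bool" where
  "wiener_integral_process M B f I \<longleftrightarrow>
     (\<forall>t\<ge>0. is_wiener_integral M B f t (I t)) \<and>
     (AE \<omega> in M. continuous_on {0..} (\<lambda>t. I t \<omega>))"


subsection \<open>The recursion\<close>

text \<open>The common recursion behind \<open>x\<^sub>n\<close> (pathwise, with the kernel \<open>K\<close> and start \<open>f = x\<^sub>1\<close>) and
  \<open>\<gamma>\<^sub>n\<close> (with the kernel \<open>\<bar>K\<bar>\<close> and start \<open>f = \<gamma>\<^sub>1\<close>).  The index \<open>0\<close> is never used by the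
  recursion; its value is a dummy.\<close>

function hierarchy :: "(real \<Rightarrow> real \<Rightarrow> real) \<Rightarrow> (real \<Rightarrow> real) \<Rightarrow> nat \<Rightarrow> real \<Rightarrow> real" where
  "hierarchy K f n t =
     (if n = 0 then 0
      else if n = 1 then f t
      else (LBINT s=0..ereal t.
              K t s * (\<Sum>j\<in>{1..n-1}. hierarchy K f j s * hierarchy K f (n - j) s)))"
  by pat_completeness auto
termination
  by (relation "Wellfounded.measure (\<lambda>(K, f, n, t). n)") auto

declare hierarchy.simps [simp del]

definition L2_norm_on :: "real \<Rightarrow> (real \<Rightarrow> real) \<Rightarrow> real" where
  "L2_norm_on T f = sqrt (LBINT s=0..ereal T. (f s)\<^sup>2)"

end

theory Submission
  imports Defs
begin

text \<open>Write \<open>x\<^sub>1(t) = w\<^sub>2(t) I\<^sub>1(t) - w\<^sub>1(t) I\<^sub>2(t)\<close> with the Wiener integrals \<open>I\<^sub>i(t) = \<integral>\<^sub>0\<^sup>t w\<^sub>i dB\<close>. On the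
event that both \<open>\<bar>I\<^sub>1\<bar>\<close> and \<open>\<bar>I\<^sub>2\<bar>\<close> stay below \<open>1/\<sigma>\<close> on \<open>[0, T]\<close>, the triangle inequality gives
\<open>\<bar>x\<^sub>1\<bar> \<le> \<gamma>\<^sub>1/\<sigma>\<close>. The recursion for \<open>\<gamma>\<^sub>n\<close> is that for \<open>x\<^sub>n\<close> with every term replaced by a bound of its
absolute value, and its right-hand side is homogeneous: the indices of the two factors add up to \<open>n\<close>,
so their powers of \<open>1/\<sigma>\<close> multiply to \<open>1/\<sigma>\<^sup>n\<close>. Induction on \<open>n\<close> therefore gives \<open>\<bar>x\<^sub>n\<bar> \<le> \<gamma>\<^sub>n/\<sigma>\<^sup>n\<close> on this one
event, for all \<open>n\<close> simultaneously (\<open>hierarchy_bound\<close>).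

The complement of the event is controlled by Doob's maximal inequality in its \<open>L\<^sup>1\<close> form: \<open>I\<^sub>i\<close> is a
continuous martingale and \<open>I\<^sub>i(T)\<close> is a centred Gaussian with standard deviation \<open>\<parallel>w\<^sub>i\<parallel>\<close>, so that \<open>\<bar>I\<^sub>i\<bar>\<close>
exceeds \<open>1/\<sigma>\<close> with probability at most \<open>\<sigma> E\<bar>I\<^sub>i(T)\<bar> = \<sigma> sqrt(2/\<pi>) \<parallel>w\<^sub>i\<parallel>\<close>. Adding the two bounds, and
using \<open>1 \<le> 2\<^bsup>n-2\<^esup>\<close>, gives the claim.

The maximal inequality is proved without filtrations or conditional expectations, directly from the
definition of the integral. For a step integrand, the integrals up to the points of a grid are
partial sums of independent centred Gaussian variables, for which the inequality is elementary
(\<open>maximal_inequality_indep_sums\<close>). The inequality passes to general integrands along mean-square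
limits, because the isometry (\<open>wiener_isometry\<close>) makes one approximating sequence for the integral over
\<open>[0, T]\<close> approximate the integrals over all the intervals \<open>[0, t]\<close> as well; it passes to all times in \<open>[0, T]\<close>
by monotone convergence over the rationals and continuity of the paths
(\<open>wiener_integral_maximal_inequality\<close>).

Two points of regularity enter. The integrals in the recursion have to exist, for which the
continuity of \<open>w\<^sub>1\<close> and \<open>w\<^sub>2\<close> is established from the inversion of the elliptic integral. And the
event in the statement, which involves uncountably many times, has to be measurable; this follows
from continuity in time, measurability at fixed times, and completeness of the probability space
(\<open>hierarchy_bound_event_measurable\<close>).\<close>

section \<open>Maximal inequality for sums of independent centred variables\<close>

lemma sets_exceeds:
  fixes X :: "'i \<Rightarrow> 'b \<Rightarrow> real"
  assumes "countable G" "\<And>t. t \<in> G \<Longrightarrow> X t \<in> borel_measurable N"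
  shows "{\<omega> \<in> space N. \<exists>t\<in>G. r t < \<bar>X t \<omega>\<bar>} \<in> sets N"
proof -
  have "{\<omega> \<in> space N. \<exists>t\<in>G. r t < \<bar>X t \<omega>\<bar>} = (\<Union>t\<in>G. {\<omega> \<in> space N. r t < \<bar>X t \<omega>\<bar>})" by auto
  also have "\<dots> \<in> sets N"
  proof (intro sets.countable_UN'' assms(1))
    fix t assume "t \<in> G"
    then have [measurable]: "X t \<in> borel_measurable N" by (rule assms(2))
    show "{\<omega> \<in> space N. r t < \<bar>X t \<omega>\<bar>} \<in> sets N" by measurable
  qed
  finally show ?thesis .
qed

text \<open>The martingale property of partial sums in the form in which it is used: the next summand is
orthogonal to every bounded function of the preceding ones.\<close>

lemma (in prob_space) indep_past_increment_mean_zero: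
  fixes \<xi> :: "nat \<Rightarrow> 'a \<Rightarrow> real" and \<phi> :: "(nat \<Rightarrow> real) \<Rightarrow> real"
  assumes indep: "indep_vars (\<lambda>_. borel) \<xi> {..<L}" and "m < L"
    and int: "integrable M (\<xi> m)" and mean: "expectation (\<xi> m) = 0"
    and \<phi>: "\<phi> \<in> borel_measurable (PiM {..<m} (\<lambda>_. borel))" and bound: "\<And>f. \<bar>\<phi> f\<bar> \<le> C"
  shows "integrable M (\<lambda>\<omega>. \<phi> (\<lambda>i\<in>{..<m}. \<xi> i \<omega>) * \<xi> m \<omega>)"
    and "expectation (\<lambda>\<omega>. \<phi> (\<lambda>i\<in>{..<m}. \<xi> i \<omega>) * \<xi> m \<omega>) = 0"
proof -
  have "indep_var borel (\<phi> \<circ> (\<lambda>\<omega>. \<lambda>i\<in>{..<m}. \<xi> i \<omega>))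
          borel ((\<lambda>f. f m) \<circ> (\<lambda>\<omega>. \<lambda>i\<in>{m}. \<xi> i \<omega>))"
    using \<open>m < L\<close> by (intro indep_var_compose[OF indep_var_restrict[OF indep] \<phi>]) auto
  then have iv: "indep_var borel (\<lambda>\<omega>. \<phi> (\<lambda>i\<in>{..<m}. \<xi> i \<omega>)) borel (\<xi> m)"
    by (simp add: comp_def)
  have meas: "(\<lambda>\<omega>. \<phi> (\<lambda>i\<in>{..<m}. \<xi> i \<omega>)) \<in> borel_measurable M"
    using indep_var_rv1[OF iv] by simp
  have int\<phi>: "integrable M (\<lambda>\<omega>. \<phi> (\<lambda>i\<in>{..<m}. \<xi> i \<omega>))"
    using bound by (intro integrable_const_bound[where B=C] meas) auto
  show "integrable M (\<lambda>\<omega>. \<phi> (\<lambda>i\<in>{..<m}. \<xi> i \<omega>) * \<xi> m \<omega>)"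
    by (rule indep_var_integrable[OF iv int\<phi> int])
  show "expectation (\<lambda>\<omega>. \<phi> (\<lambda>i\<in>{..<m}. \<xi> i \<omega>) * \<xi> m \<omega>) = 0"
    by (subst indep_var_lebesgue_integral[OF iv int\<phi> int]) (simp add: mean)
qed

text \<open>Doob's inequality. The induction on \<open>m\<close> shows \<open>r P(D\<^sub>m) \<le> E(\<bar>S\<^sub>m\<bar>; D\<^sub>m)\<close>, where \<open>D\<^sub>m\<close> is the event that the
level \<open>r\<close> has been exceeded by time \<open>m\<close>. On the old event \<open>D\<^sub>m\<close> the expectation of \<open>\<bar>S\<bar>\<close> cannot decrease,
since \<open>\<bar>S\<^sub>m\<^sub>+\<^sub>1\<bar> \<ge> \<bar>S\<^sub>m\<bar> + sgn(S\<^sub>m) \<xi>\<^sub>m\<close> and the last term is orthogonal to the past; on the newly added part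
\<open>\<bar>S\<^sub>m\<^sub>+\<^sub>1\<bar>\<close> exceeds \<open>r\<close>.\<close>

lemma (in prob_space) maximal_inequality_indep_sums:
  fixes \<xi> :: "nat \<Rightarrow> 'a \<Rightarrow> real"
  assumes indep: "indep_vars (\<lambda>_. borel) \<xi> {..<L}"
    and int: "\<And>i. i < L \<Longrightarrow> integrable M (\<xi> i)"
    and mean: "\<And>i. i < L \<Longrightarrow> expectation (\<xi> i) = 0"
    and "0 \<le> r"
  shows "r * prob {\<omega> \<in> space M. \<exists>j\<le>L. r < \<bar>\<Sum>i<j. \<xi> i \<omega>\<bar>} \<le> expectation (\<lambda>\<omega>. \<bar>\<Sum>i<L. \<xi> i \<omega>\<bar>)"
proof -
  define S where "S m \<omega> = (\<Sum>i<m. \<xi> i \<omega>)" for m \<omega>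
  define D where "D m = {\<omega> \<in> space M. \<exists>j\<le>m. r < \<bar>S j \<omega>\<bar>}" for m
  have meas_\<xi> [measurable]: "i < L \<Longrightarrow> \<xi> i \<in> borel_measurable M" for i
    using int[of i] by auto
  have intS: "m \<le> L \<Longrightarrow> integrable M (S m)" for m
    unfolding S_def by (intro Bochner_Integration.integrable_sum int) auto
  have measS: "m \<le> L \<Longrightarrow> S m \<in> borel_measurable M" for m
    using intS[of m] by auto
  have measD: "m \<le> L \<Longrightarrow> D m \<in> sets M" for m
    using sets_exceeds[of "{..m}" S M "\<lambda>_. r"] measS by (simp add: D_def Bex_def)
  have intSD: "integrable M (\<lambda>\<omega>. \<bar>S k \<omega>\<bar> * indicator (D m) \<omega>)" if "k \<le> L" "m \<le> L" for k m
    using integrable_mult_indicator[OF measD[OF that(2)] integrable_abs[OF intS[OF that(1)]]]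
    by (simp add: mult.commute)
  have step: "m \<le> L \<Longrightarrow> r * prob (D m) \<le> expectation (\<lambda>\<omega>. \<bar>S m \<omega>\<bar> * indicator (D m) \<omega>)" for m
  proof (induction m)
    case 0
    have "D 0 = {}" using \<open>0 \<le> r\<close> by (auto simp: D_def S_def)
    then show ?case by simp
  next
    case (Suc m)
    then have m: "m \<le> L" "m < L" by auto
    define New where "New = D (Suc m) - D m"
    have Dsub: "D m \<subseteq> D (Suc m)" by (auto simp: D_def intro: le_SucI)
    have New: "New \<in> sets M" unfolding New_def using measD[of m] measD[of "Suc m"] Suc.prems m by auto
    have Dsplit: "indicator (D (Suc m)) \<omega> = indicator (D m) \<omega> + (indicator New \<omega> :: real)" for \<omega>
      using Dsub by (auto simp: New_def indicator_def)
    have intN: "integrable M (\<lambda>\<omega>. \<bar>S (Suc m) \<omega>\<bar> * indicator New \<omega>)"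
      using integrable_mult_indicator[OF New integrable_abs[OF intS[OF Suc.prems]]]
      by (simp add: mult.commute)
    \<comment> \<open>The test function of the past is \<open>sgn (S m)\<close> on \<open>D m\<close>, as a function of the first \<open>m\<close> summands.\<close>
    define \<phi> :: "(nat \<Rightarrow> real) \<Rightarrow> real" where "\<phi> f = sgn (\<Sum>i<m. f i) *
        (if \<exists>j\<in>{..m}. r < \<bar>\<Sum>i<j. f i\<bar> then 1 else 0)" for f
    have \<phi>S: "\<phi> (\<lambda>i\<in>{..<m}. \<xi> i \<omega>) = sgn (S m \<omega>) * indicator (D m) \<omega>" if "\<omega> \<in> space M" for \<omega>
    proof -
      have "(\<Sum>i<j. (\<lambda>i\<in>{..<m}. \<xi> i \<omega>) i) = S j \<omega>" if "j \<le> m" for j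
        unfolding S_def using that by (intro sum.cong) auto
      then show ?thesis using that by (auto simp: \<phi>_def D_def indicator_def)
    qed
    have bound: "\<bar>\<phi> f\<bar> \<le> 1" for f by (simp add: \<phi>_def abs_mult abs_sgn_eq)
    have comp: "(\<lambda>f. \<Sum>i<j. f i) \<in> borel_measurable (PiM {..<m} (\<lambda>_. borel :: real measure))"
      if "j \<le> m" for j
      using that by (intro borel_measurable_sum measurable_component_singleton) auto
    have \<phi>m: "\<phi> \<in> borel_measurable (PiM {..<m} (\<lambda>_. borel))"
    proof -
      have "Measurable.pred (PiM {..<m} (\<lambda>_. borel)) (\<lambda>f. \<exists>j\<in>{..m}. r < \<bar>\<Sum>i<j. f i :: real\<bar>)"
        using comp by (intro pred_intros_finite) auto
      then show ?thesis unfolding \<phi>_def using comp[of m]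
        by (intro borel_measurable_times measurable_If) (auto simp: measurable_def sgn_if)
    qed
    note orth = indep_past_increment_mean_zero[OF indep \<open>m < L\<close> int[OF \<open>m < L\<close>] mean[OF \<open>m < L\<close>] \<phi>m bound]
    let ?\<phi> = "\<lambda>\<omega>. \<phi> (\<lambda>i\<in>{..<m}. \<xi> i \<omega>)"
    have "expectation (\<lambda>\<omega>. \<bar>S m \<omega>\<bar> * indicator (D m) \<omega>)
        = expectation (\<lambda>\<omega>. \<bar>S m \<omega>\<bar> * indicator (D m) \<omega> + ?\<phi> \<omega> * \<xi> m \<omega>)"
      using orth by (subst Bochner_Integration.integral_add) (auto intro!: intSD m)
    also have "\<dots> \<le> expectation (\<lambda>\<omega>. \<bar>S (Suc m) \<omega>\<bar> * indicator (D m) \<omega>)"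
    proof (rule integral_mono)
      fix \<omega> assume "\<omega> \<in> space M"
      then show "\<bar>S m \<omega>\<bar> * indicator (D m) \<omega> + ?\<phi> \<omega> * \<xi> m \<omega> \<le> \<bar>S (Suc m) \<omega>\<bar> * indicator (D m) \<omega>"
        by (auto simp: \<phi>S S_def indicator_def sgn_if)
    qed (use orth intSD[of m m] intSD[of "Suc m" m] m Suc.prems in auto)
    finally have old: "r * prob (D m) \<le> expectation (\<lambda>\<omega>. \<bar>S (Suc m) \<omega>\<bar> * indicator (D m) \<omega>)"
      using Suc.IH m by linarith
    have new: "r * prob New \<le> expectation (\<lambda>\<omega>. \<bar>S (Suc m) \<omega>\<bar> * indicator New \<omega>)"
    proof -
      have "r * prob New = expectation (\<lambda>\<omega>. r * indicator New \<omega>)" using New by simp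
      also have "\<dots> \<le> expectation (\<lambda>\<omega>. \<bar>S (Suc m) \<omega>\<bar> * indicator New \<omega>)"
      proof (rule integral_mono)
        show "integrable M (\<lambda>\<omega>. r * indicator New \<omega>)" using New by (auto simp: emeasure_eq_measure)
      qed (use intN in \<open>auto simp: New_def D_def indicator_def le_Suc_eq\<close>)
      finally show ?thesis .
    qed
    have "prob (D (Suc m)) = prob (D m) + prob New"
      using finite_measure_Union[OF measD[OF m(1)] New] Dsub
      by (metis Diff_disjoint New_def Un_Diff_cancel sup.absorb2)
    moreover have "expectation (\<lambda>\<omega>. \<bar>S (Suc m) \<omega>\<bar> * indicator (D (Suc m)) \<omega>)
        = expectation (\<lambda>\<omega>. \<bar>S (Suc m) \<omega>\<bar> * indicator (D m) \<omega>)
        + expectation (\<lambda>\<omega>. \<bar>S (Suc m) \<omega>\<bar> * indicator New \<omega>)"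
      unfolding Dsplit distrib_left using intN intSD[of "Suc m" m] m Suc.prems
      by (intro Bochner_Integration.integral_add) auto
    ultimately show ?case using old new by (simp add: distrib_left)
  qed
  have "r * prob (D L) \<le> expectation (\<lambda>\<omega>. \<bar>S L \<omega>\<bar> * indicator (D L) \<omega>)" by (rule step) simp
  also have "\<dots> \<le> expectation (\<lambda>\<omega>. \<bar>S L \<omega>\<bar>)"
    using intS[of L] intSD[of L L] by (intro integral_mono) (auto simp: indicator_def)
  finally show ?thesis by (simp add: D_def S_def)
qed

section \<open>Step integrals of Brownian motion and the isometry\<close>

lemma integrable_mult_of_squares:
  fixes X Y :: "'b \<Rightarrow> real"
  assumes [measurable]: "X \<in> borel_measurable N" "Y \<in> borel_measurable N"
    and "integrable N (\<lambda>z. (X z)\<^sup>2)" "integrable N (\<lambda>z. (Y z)\<^sup>2)"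
  shows "integrable N (\<lambda>z. X z * Y z)"
proof (rule Bochner_Integration.integrable_bound)
  show "integrable N (\<lambda>z. (X z)\<^sup>2 + (Y z)\<^sup>2)" using assms by auto
  have "\<bar>u * v\<bar> \<le> u\<^sup>2 + v\<^sup>2" for u v :: real
  proof -
    have "2 * (\<bar>u\<bar> * \<bar>v\<bar>) \<le> u\<^sup>2 + v\<^sup>2"
      using sum_squares_bound[of "\<bar>u\<bar>" "\<bar>v\<bar>"] by simp
    then show ?thesis using mult_nonneg_nonneg[of "\<bar>u\<bar>" "\<bar>v\<bar>"] by (simp only: abs_mult) linarith
  qed
  then show "AE z in N. norm (X z * Y z) \<le> norm ((X z)\<^sup>2 + (Y z)\<^sup>2)" by (simp add: abs_le_iff)
qed measurable

lemma integrable_square_diff: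
  fixes X Y :: "'b \<Rightarrow> real"
  assumes "X \<in> borel_measurable N" "Y \<in> borel_measurable N"
    and "integrable N (\<lambda>z. (X z)\<^sup>2)" "integrable N (\<lambda>z. (Y z)\<^sup>2)"
  shows "integrable N (\<lambda>z. (X z - Y z)\<^sup>2)"
  using integrable_mult_of_squares[OF assms] assms by (auto simp: power2_diff mult.assoc)

text \<open>The triangle inequality in \<open>L\<^sup>2\<close> with squared norms, at the price of a factor, so that convergence to
zero can be shown for the integrals of squares themselves.\<close>

lemma integral_square_triangle:
  fixes X Y Z :: "'b \<Rightarrow> real"
  assumes "X \<in> borel_measurable N" "Y \<in> borel_measurable N" "Z \<in> borel_measurable N"
    and "integrable N (\<lambda>z. (X z)\<^sup>2)" "integrable N (\<lambda>z. (Y z)\<^sup>2)" "integrable N (\<lambda>z. (Z z)\<^sup>2)"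
  shows "(\<integral>z. (X z - Z z)\<^sup>2 \<partial>N) \<le> 2 * (\<integral>z. (X z - Y z)\<^sup>2 \<partial>N) + 2 * (\<integral>z. (Y z - Z z)\<^sup>2 \<partial>N)"
proof -
  note i = integrable_square_diff[OF assms(1,2,4,5)] integrable_square_diff[OF assms(2,3,5,6)]
    integrable_square_diff[OF assms(1,3,4,6)]
  have "(u - w)\<^sup>2 \<le> 2 * (u - v)\<^sup>2 + 2 * (v - w)\<^sup>2" for u v w :: real
    using sum_squares_bound[of "u - v" "v - w"] power2_sum[of "u - v" "v - w"] by simp
  then have "(\<integral>z. (X z - Z z)\<^sup>2 \<partial>N) \<le> (\<integral>z. 2 * (X z - Y z)\<^sup>2 + 2 * (Y z - Z z)\<^sup>2 \<partial>N)"
    using i by (intro integral_mono) auto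
  also have "\<dots> = 2 * (\<integral>z. (X z - Y z)\<^sup>2 \<partial>N) + 2 * (\<integral>z. (Y z - Z z)\<^sup>2 \<partial>N)"
    using i by simp
  finally show ?thesis .
qed

locale brownian_motion = prob_space M for M :: "'a measure" +
  fixes B :: "real \<Rightarrow> 'a \<Rightarrow> real"
  assumes bm: "std_brownian_motion M B"
begin

lemma measurable_B: "0 \<le> t \<Longrightarrow> B t \<in> borel_measurable M"
  using bm by (auto simp: std_brownian_motion_def)

lemma increment_normal:
  "0 \<le> s \<Longrightarrow> s < t \<Longrightarrow>
    distributed M lborel (\<lambda>\<omega>. B t \<omega> - B s \<omega>) (normal_density 0 (sqrt (t - s)))"
  using bm by (auto simp: std_brownian_motion_def)

lemma increments_indep:
  "0 \<le> p 0 \<Longrightarrow> (\<And>i. i < N \<Longrightarrow> p i < p (Suc i)) \<Longrightarrow>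
    indep_vars (\<lambda>_. borel) (\<lambda>i \<omega>. B (p (Suc i)) \<omega> - B (p i) \<omega>) {..<N}"
  for p :: "nat \<Rightarrow> real"
  using bm by (auto simp: std_brownian_motion_def)

lemma increment_moments:
  assumes "0 \<le> s" "s \<le> t"
  shows "integrable M (\<lambda>\<omega>. (B t \<omega> - B s \<omega>)\<^sup>2)" "expectation (\<lambda>\<omega>. (B t \<omega> - B s \<omega>)\<^sup>2) = t - s"
    and "integrable M (\<lambda>\<omega>. B t \<omega> - B s \<omega>)" "expectation (\<lambda>\<omega>. B t \<omega> - B s \<omega>) = 0"
proof -
  have meas: "(\<lambda>\<omega>. B t \<omega> - B s \<omega>) \<in> borel_measurable M"
    using assms by (intro borel_measurable_diff measurable_B) auto
  have "integrable M (\<lambda>\<omega>. (B t \<omega> - B s \<omega>)\<^sup>2) \<and> expectation (\<lambda>\<omega>. (B t \<omega> - B s \<omega>)\<^sup>2) = t - s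
    \<and> expectation (\<lambda>\<omega>. B t \<omega> - B s \<omega>) = 0"
  proof (cases "s = t")
    case False
    then have "s < t" using assms by simp
    define sd where "sd = sqrt (t - s)"
    have sd: "0 < sd" "sd\<^sup>2 = t - s" using \<open>s < t\<close> by (auto simp: sd_def)
    note D = increment_normal[OF assms(1) \<open>s < t\<close>, folded sd_def]
    have 0: "expectation (\<lambda>\<omega>. B t \<omega> - B s \<omega>) = 0"
      by (rule normal_distributed_expectation[OF sd(1) D])
    have "integrable lborel (\<lambda>x. normal_density 0 sd x * x\<^sup>2)"
      using integrable_normal_moment[OF sd(1), of 0 2] by simp
    then have i: "integrable M (\<lambda>\<omega>. (B t \<omega> - B s \<omega>)\<^sup>2)"
      by (subst (asm) distributed_integrable[OF D]) auto
    show ?thesis using normal_distributed_variance[OF sd(1) D] i 0 sd by simp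
  qed simp
  then show sq: "integrable M (\<lambda>\<omega>. (B t \<omega> - B s \<omega>)\<^sup>2)" and "expectation (\<lambda>\<omega>. (B t \<omega> - B s \<omega>)\<^sup>2) = t - s"
    and "expectation (\<lambda>\<omega>. B t \<omega> - B s \<omega>) = 0" by auto
  show "integrable M (\<lambda>\<omega>. B t \<omega> - B s \<omega>)"
    by (rule square_integrable_imp_integrable[OF meas sq])
qed

lemma integrable_increment_product:
  assumes "0 \<le> a" "a \<le> b" "0 \<le> c" "c \<le> d"
  shows "integrable M (\<lambda>\<omega>. (B b \<omega> - B a \<omega>) * (B d \<omega> - B c \<omega>))"
proof -
  have "0 \<le> b" "0 \<le> d" using assms by auto
  then show ?thesis using assms
    by (intro integrable_mult_of_squares increment_moments borel_measurable_diff measurable_B) auto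
qed

lemma covariance_from_0:
  assumes "0 \<le> s" "s \<le> t"
  shows "expectation (\<lambda>\<omega>. (B s \<omega> - B 0 \<omega>) * (B t \<omega> - B 0 \<omega>)) = s"
proof (cases "s = 0 \<or> s = t")
  case True
  then show ?thesis using increment_moments(2)[of 0 s] assms by (auto simp: power2_eq_square)
next
  case False
  then have st: "0 < s" "s < t" using assms by auto
  define p where "p i = (if i = 0 then 0 else if i = Suc 0 then s else t)" for i :: nat
  have p: "p 0 = 0" "p (Suc 0) = s" "p (Suc (Suc 0)) = t" by (auto simp: p_def)
  have "indep_vars (\<lambda>_. borel) (\<lambda>i \<omega>. B (p (Suc i)) \<omega> - B (p i) \<omega>) {..<2}"
    using st by (intro increments_indep) (auto simp: p_def less_2_cases_iff)
  then have "indep_vars (\<lambda>_. borel) (\<lambda>i \<omega>. B (p (Suc i)) \<omega> - B (p i) \<omega>) (insert 0 {1})"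
    by (rule indep_vars_subset) auto
  from indep_vars_sum[OF _ _ this]
  have "indep_var borel (\<lambda>\<omega>. B s \<omega> - B 0 \<omega>) borel (\<lambda>\<omega>. B t \<omega> - B s \<omega>)" by (simp add: p)
  from indep_var_lebesgue_integral[OF this]
  have "expectation (\<lambda>\<omega>. (B s \<omega> - B 0 \<omega>) * (B t \<omega> - B s \<omega>)) = 0"
    using increment_moments[of 0 s] increment_moments[of s t] assms by simp
  moreover have "expectation (\<lambda>\<omega>. (B s \<omega> - B 0 \<omega>) * (B t \<omega> - B 0 \<omega>))
      = expectation (\<lambda>\<omega>. (B s \<omega> - B 0 \<omega>) * (B s \<omega> - B 0 \<omega>) + (B s \<omega> - B 0 \<omega>) * (B t \<omega> - B s \<omega>))"
    by (simp add: algebra_simps)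
  moreover have "\<dots> = expectation (\<lambda>\<omega>. (B s \<omega> - B 0 \<omega>) * (B s \<omega> - B 0 \<omega>))
      + expectation (\<lambda>\<omega>. (B s \<omega> - B 0 \<omega>) * (B t \<omega> - B s \<omega>))"
    using assms by (intro Bochner_Integration.integral_add integrable_increment_product) auto
  ultimately show ?thesis using increment_moments(2)[of 0 s] assms
    by (simp add: power2_eq_square)
qed

text \<open>The definition fixes \<open>B 0 = 0\<close> only almost surely, so covariances are taken of increments from \<open>0\<close>.\<close>

lemma covariance_from_0_min:
  assumes "0 \<le> s" "0 \<le> t"
  shows "expectation (\<lambda>\<omega>. (B s \<omega> - B 0 \<omega>) * (B t \<omega> - B 0 \<omega>)) = min s t"
  using covariance_from_0[of s t] covariance_from_0[of t s] assms
  by (cases "s \<le> t") (auto simp: mult.commute)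

text \<open>Expanding both increments around time \<open>0\<close> expresses the covariance through four minima, which combine
to the length of the overlap of the two intervals.\<close>

lemma increment_covariance:
  assumes "0 \<le> a" "a \<le> b" "0 \<le> c" "c \<le> d"
  shows "expectation (\<lambda>\<omega>. (B b \<omega> - B a \<omega>) * (B d \<omega> - B c \<omega>))
    = (\<integral>s. indicator {a<..b} s * indicator {c<..d} s \<partial>lborel)"
proof -
  let ?W = "\<lambda>s \<omega>. B s \<omega> - B 0 \<omega>"
  have i: "integrable M (\<lambda>\<omega>. ?W s \<omega> * ?W t \<omega>)" if "0 \<le> s" "0 \<le> t" for s t
    using that by (intro integrable_increment_product) auto
  have nn: "0 \<le> b" "0 \<le> d" using assms by auto
  have "expectation (\<lambda>\<omega>. (B b \<omega> - B a \<omega>) * (B d \<omega> - B c \<omega>))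
    = expectation (\<lambda>\<omega>. (?W b \<omega> * ?W d \<omega> - ?W b \<omega> * ?W c \<omega>) - (?W a \<omega> * ?W d \<omega> - ?W a \<omega> * ?W c \<omega>))"
    by (simp add: algebra_simps)
  also have "\<dots> = (min b d - min b c) - (min a d - min a c)"
    using assms nn i
    by (simp only: Bochner_Integration.integral_diff Bochner_Integration.integrable_diff
          covariance_from_0_min)
  also have "\<dots> = (if max a c \<le> min b d then min b d - max a c else 0)"
    using assms by (auto simp: min_def max_def)
  also have "\<dots> = measure lborel {max a c<..min b d}"
  proof (cases "max a c \<le> min b d")
    case False
    then have "{max a c<..min b d} = {}" by auto
    moreover have "(if max a c \<le> min b d then min b d - max a c else 0) = 0" using False by (rule if_not_P)
    ultimately show ?thesis by (simp only: measure_empty)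
  qed simp
  also have "\<dots> = (\<integral>s. indicator {max a c<..min b d} s \<partial>lborel)" by simp
  also have "\<dots> = (\<integral>s. indicator {a<..b} s * indicator {c<..d} s \<partial>lborel)"
    by (simp only: indicator_inter_arith[symmetric] Int_greaterThanAtMost)
  finally show ?thesis .
qed

text \<open>The isometry for step integrands whose intervals may overlap or be empty: both sides are bilinear, so
it reduces to the covariance of two increments. No common refinement of partitions is involved, which
is what makes the comparison of integrals over different partitions below easy.\<close>

lemma wiener_isometry:
  fixes a b v :: "'i \<Rightarrow> real"
  assumes "\<And>i. i \<in> A \<Longrightarrow> 0 \<le> a i \<and> a i \<le> b i"
  shows "integrable M (\<lambda>\<omega>. (\<Sum>i\<in>A. v i * (B (b i) \<omega> - B (a i) \<omega>))\<^sup>2)"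
    and "expectation (\<lambda>\<omega>. (\<Sum>i\<in>A. v i * (B (b i) \<omega> - B (a i) \<omega>))\<^sup>2)
      = (\<integral>s. (\<Sum>i\<in>A. v i * indicator {a i<..b i} s)\<^sup>2 \<partial>lborel)"
proof -
  let ?D = "\<lambda>i \<omega>. B (b i) \<omega> - B (a i) \<omega>" and ?e = "\<lambda>i s. indicator {a i<..b i} s :: real"
  have sqD: "(\<Sum>i\<in>A. v i * ?D i \<omega>)\<^sup>2 = (\<Sum>i\<in>A. \<Sum>j\<in>A. v i * v j * (?D i \<omega> * ?D j \<omega>))" for \<omega>
    by (simp add: power2_eq_square sum_product algebra_simps)
  have sqe: "(\<Sum>i\<in>A. v i * ?e i s)\<^sup>2 = (\<Sum>i\<in>A. \<Sum>j\<in>A. v i * v j * (?e i s * ?e j s))" for s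
    by (simp add: power2_eq_square sum_product algebra_simps)
  have iD: "integrable M (\<lambda>\<omega>. v i * v j * (?D i \<omega> * ?D j \<omega>))" if "i \<in> A" "j \<in> A" for i j
    using assms[OF that(1)] assms[OF that(2)]
    by (intro integrable_mult_right integrable_increment_product) auto
  have ie: "integrable lborel (\<lambda>s. v i * v j * (?e i s * ?e j s))" for i j
    unfolding indicator_inter_arith[symmetric]
    by (intro integrable_mult_right integrable_real_indicator emeasure_bounded_finite bounded_Int) auto
  show "integrable M (\<lambda>\<omega>. (\<Sum>i\<in>A. v i * ?D i \<omega>)\<^sup>2)"
    unfolding sqD by (intro Bochner_Integration.integrable_sum iD)
  have "expectation (\<lambda>\<omega>. (\<Sum>i\<in>A. v i * ?D i \<omega>)\<^sup>2)
      = (\<Sum>i\<in>A. \<Sum>j\<in>A. v i * v j * expectation (\<lambda>\<omega>. ?D i \<omega> * ?D j \<omega>))"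
    unfolding sqD using iD by (simp add: Bochner_Integration.integral_sum Bochner_Integration.integrable_sum)
  also have "\<dots> = (\<Sum>i\<in>A. \<Sum>j\<in>A. v i * v j * (\<integral>s. ?e i s * ?e j s \<partial>lborel))"
    using assms by (intro sum.cong arg_cong2[where f="(*)"] refl increment_covariance) auto
  also have "\<dots> = (\<integral>s. (\<Sum>i\<in>A. v i * ?e i s)\<^sup>2 \<partial>lborel)"
    unfolding sqe using ie by (simp add: Bochner_Integration.integral_sum Bochner_Integration.integrable_sum)
  finally show "expectation (\<lambda>\<omega>. (\<Sum>i\<in>A. v i * ?D i \<omega>)\<^sup>2)
      = (\<integral>s. (\<Sum>i\<in>A. v i * ?e i s)\<^sup>2 \<partial>lborel)" .
qed

text \<open>The isometry applied to the disjoint union of the two index sets, with the sign of the second family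
reversed.\<close>

lemma wiener_isometry_diff:
  fixes a b v :: "'i \<Rightarrow> real" and a' b' v' :: "'j \<Rightarrow> real"
  assumes "finite A" "\<And>i. i \<in> A \<Longrightarrow> 0 \<le> a i \<and> a i \<le> b i"
    and "finite A'" "\<And>i. i \<in> A' \<Longrightarrow> 0 \<le> a' i \<and> a' i \<le> b' i"
  shows "expectation (\<lambda>\<omega>. ((\<Sum>i\<in>A. v i * (B (b i) \<omega> - B (a i) \<omega>)) -
            (\<Sum>i\<in>A'. v' i * (B (b' i) \<omega> - B (a' i) \<omega>)))\<^sup>2)
      = (\<integral>s. ((\<Sum>i\<in>A. v i * indicator {a i<..b i} s) -
            (\<Sum>i\<in>A'. v' i * indicator {a' i<..b' i} s))\<^sup>2 \<partial>lborel)"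
proof -
  have "i \<in> A <+> A' \<Longrightarrow> 0 \<le> case_sum a a' i \<and> case_sum a a' i \<le> case_sum b b' i" for i
    using assms by auto
  from wiener_isometry(2)[of "A <+> A'" "case_sum a a'" "case_sum b b'" "case_sum v (\<lambda>i. - v' i)", OF this]
  show ?thesis
    unfolding sum.Plus[OF assms(1,3)] by (simp add: comp_def sum_negf del: indicator_simps)
qed

end

section \<open>Step integrals along a grid\<close>

lemma finite_set_increasing_enumeration:
  fixes P :: "'b::linorder set"
  assumes "finite P" "P \<noteq> {}"
  obtains r :: "nat \<Rightarrow> 'b" and L where "r ` {..L} = P" "\<And>i j. i < j \<Longrightarrow> j \<le> L \<Longrightarrow> r i < r j"
proof
  let ?xs = "sorted_list_of_set P"
  have len: "length ?xs = card P" "card P > 0" using assms by (auto simp: card_gt_0_iff)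
  then have "{..card P - 1} = {..<length ?xs}" by auto
  then show "(!) ?xs ` {..card P - 1} = P"
    using assms by (simp add: nth_image[of "length ?xs" ?xs, simplified] lessThan_atLeast0)
  show "?xs ! i < ?xs ! j" if "i < j" "j \<le> card P - 1" for i j
    using that len strict_sorted_list_of_set[of P] by (auto simp: sorted_wrt_iff_nth_less)
qed

text \<open>Telescoping: an increment between two grid points, stopped at a third one, is the sum of the
grid increments inside the corresponding interval.\<close>

lemma truncated_increment_on_grid:
  fixes b :: "real \<Rightarrow> real" and r :: "nat \<Rightarrow> real"
  assumes inc: "\<And>i j. i < j \<Longrightarrow> j \<le> L \<Longrightarrow> r i < r j" and "k \<le> L" "k' \<le> L" "k \<le> k'" "m \<le> L"
  shows "b (min (r k') (r m)) - b (min (r k) (r m))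
    = (\<Sum>l<m. indicator {r k<..r k'} (r (Suc l)) * (b (r (Suc l)) - b (r l)))"
  using \<open>m \<le> L\<close>
proof (induction m)
  case 0
  have "r 0 \<le> r i" if "i \<le> L" for i using inc[of 0 i] that by (cases "i = 0") auto
  then show ?case using assms by (simp add: min_absorb2)
next
  case (Suc m)
  have le: "r i \<le> r j" if "i \<le> j" "j \<le> L" for i j
    using inc[of i j] that by (cases "i = j") auto
  have lt: "r i < r j \<longleftrightarrow> i < j" if "i \<le> L" "j \<le> L" for i j
    using inc[of i j] le[of j i] that by (cases "i < j") auto
  have min: "min (r i) (r j) = r (min i j)" if "i \<le> L" "j \<le> L" for i j
    using le[of i j] le[of j i] that by (auto simp: min_def)
  have ind: "indicator {r k<..r k'} (r (Suc m)) = (if k < Suc m \<and> Suc m \<le> k' then 1 else 0 :: real)"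
    using lt[of k "Suc m"] lt[of k' "Suc m"] assms Suc.prems by (auto simp: indicator_def not_less[symmetric])
  have "b (r (min k' (Suc m))) - b (r (min k (Suc m))) = b (r (min k' m)) - b (r (min k m))
      + (if k < Suc m \<and> Suc m \<le> k' then 1 else 0) * (b (r (Suc m)) - b (r m))"
    using \<open>k \<le> k'\<close> by (cases "k \<le> m"; cases "k' \<le> m") (auto simp: min_def le_Suc_eq)
  then show ?case using Suc.IH Suc.prems assms by (simp add: min ind)
qed

text \<open>Stopped at a grid point, a step integral is a partial sum over the grid, with coefficients that do
not depend on the stopping time. This exhibits the integrals at all grid times as the partial sums
of a single sequence of independent variables.\<close>

lemma truncated_step_sum_on_grid:
  fixes b :: "real \<Rightarrow> real" and r p :: "nat \<Rightarrow> real"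
  assumes inc: "\<And>i j. i < j \<Longrightarrow> j \<le> L \<Longrightarrow> r i < r j" and "m \<le> L"
    and p: "\<And>i. i \<le> N \<Longrightarrow> p i \<in> r ` {..L}" "\<And>i. i < N \<Longrightarrow> p i \<le> p (Suc i)"
  shows "(\<Sum>i<N. v i * (b (min (p (Suc i)) (r m)) - b (min (p i) (r m))))
    = (\<Sum>l<m. step_fun N p v (r (Suc l)) * (b (r (Suc l)) - b (r l)))"
proof -
  have trunc: "b (min (p (Suc i)) (r m)) - b (min (p i) (r m))
      = (\<Sum>l<m. indicator {p i<..p (Suc i)} (r (Suc l)) * (b (r (Suc l)) - b (r l)))" if "i < N" for i
  proof -
    note iN = \<open>i < N\<close>
    obtain k k' where k: "p i = r k" "p (Suc i) = r k'" "k \<le> L" "k' \<le> L"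
      using p(1)[of i] p(1)[of "Suc i"] iN by auto
    then have "k \<le> k'" using p(2)[OF iN] inc[of k' k] by (cases "k \<le> k'") auto
    show ?thesis unfolding k by (rule truncated_increment_on_grid) fact+
  qed
  have "(\<Sum>i<N. v i * (b (min (p (Suc i)) (r m)) - b (min (p i) (r m))))
      = (\<Sum>i<N. \<Sum>l<m. v i * indicator {p i<..p (Suc i)} (r (Suc l)) * (b (r (Suc l)) - b (r l)))"
    by (intro sum.cong refl) (simp only: lessThan_iff trunc sum_distrib_left mult.assoc)
  also have "\<dots> = (\<Sum>l<m. \<Sum>i<N. v i * indicator {p i<..p (Suc i)} (r (Suc l)) * (b (r (Suc l)) - b (r l)))"
    by (rule sum.swap)
  finally show ?thesis by (simp only: step_fun_def sum_distrib_right)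
qed

lemma partition_mono:
  fixes p :: "nat \<Rightarrow> real"
  assumes "\<And>i. i < N \<Longrightarrow> p i < p (Suc i)" "i \<le> j" "j \<le> N"
  shows "p i \<le> p j"
  using assms(2,3)
proof (induction j)
  case (Suc j)
  then show ?case using assms(1)[of j] by (cases "i = Suc j") auto
qed auto

context brownian_motion
begin

text \<open>The integral over \<open>[0, t]\<close> of the step function given by \<open>p\<close> and \<open>v\<close>, for \<open>t\<close> not necessarily a partition
point.\<close>

definition truncated_integral :: "nat \<Rightarrow> (nat \<Rightarrow> real) \<Rightarrow> (nat \<Rightarrow> real) \<Rightarrow> real \<Rightarrow> 'a \<Rightarrow> real" where
  "truncated_integral N p v t \<omega> = (\<Sum>i<N. v i * (B (min (p (Suc i)) t) \<omega> - B (min (p i) t) \<omega>))"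

text \<open>A step integral is centred Gaussian, possibly degenerate, and the mean absolute value of a centred Gaussian is \<open>sqrt(2/\<pi>)\<close>
times its standard deviation. This is the source of the constant in the final estimate.\<close>

lemma step_integral_abs_moment:
  assumes p: "0 \<le> p 0" "\<And>i. i < N \<Longrightarrow> p i < p (Suc i)"
  shows "expectation (\<lambda>\<omega>. \<bar>step_integral B N p v \<omega>\<bar>) = sqrt (2 / pi) * sqrt (\<integral>s. (step_fun N p v s)\<^sup>2 \<partial>lborel)"
proof -
  let ?S = "step_integral B N p v"
  have nn: "i \<le> N \<Longrightarrow> 0 \<le> p i" for i using partition_mono[of N p 0 i] p by force
  have sq: "expectation (\<lambda>\<omega>. (?S \<omega>)\<^sup>2) = (\<integral>s. (step_fun N p v s)\<^sup>2 \<partial>lborel)"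
    unfolding step_integral_def step_fun_def
    using nn p(2) by (intro wiener_isometry) (auto intro: less_imp_le)
  \<comment> \<open>Only the non-degenerate summands have a normal density; the others vanish.\<close>
  define J where "J = {i. i < N \<and> v i \<noteq> 0}"
  have SJ: "?S = (\<lambda>\<omega>. \<Sum>i\<in>J. 0 + v i * (B (p (Suc i)) \<omega> - B (p i) \<omega>))"
    unfolding step_integral_def fun_eq_iff J_def by (auto intro!: sum.mono_neutral_right)
  have "expectation (\<lambda>\<omega>. \<bar>?S \<omega>\<bar>) = sqrt (2 / pi) * sqrt (expectation (\<lambda>\<omega>. (?S \<omega>)\<^sup>2))"
  proof (cases "J = {}")
    case False
    define sd where "sd = sqrt (\<Sum>i\<in>J. (\<bar>v i\<bar> * sqrt (p (Suc i) - p i))\<^sup>2)"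
    have J: "finite J" "\<And>i. i \<in> J \<Longrightarrow> i < N \<and> v i \<noteq> 0" by (auto simp: J_def)
    have pos: "i \<in> J \<Longrightarrow> 0 < \<bar>v i\<bar> * sqrt (p (Suc i) - p i)" for i
      using J(2)[of i] p(2)[of i] by auto
    have "0 < (\<Sum>i\<in>J. (\<bar>v i\<bar> * sqrt (p (Suc i) - p i))\<^sup>2)"
      using J(1) False by (intro sum_pos zero_less_power pos)
    then have sd: "0 < sd" by (simp add: sd_def)
    have "indep_vars (\<lambda>_. borel) (\<lambda>i \<omega>. B (p (Suc i)) \<omega> - B (p i) \<omega>) {..<N}"
      using p by (rule increments_indep)
    then have "indep_vars (\<lambda>_. borel) (\<lambda>i \<omega>. 0 + v i * (B (p (Suc i)) \<omega> - B (p i) \<omega>)) {..<N}"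
      by (rule indep_vars_compose2) simp
    then have ind: "indep_vars (\<lambda>_. borel) (\<lambda>i \<omega>. 0 + v i * (B (p (Suc i)) \<omega> - B (p i) \<omega>)) J"
      by (rule indep_vars_subset) (auto simp: J_def)
    \<comment> \<open>The summand \<open>0 +\<close> and the factor \<open>* 0\<close> match the form of the affine transformation rule for normal densities.\<close>
    have D: "distributed M lborel ?S (normal_density (\<Sum>i\<in>J. 0 + v i * 0) sd)"
      unfolding SJ sd_def
    proof (rule sum_indep_normal[OF J(1) False ind pos])
      fix i assume i: "i \<in> J"
      then have "distributed M lborel (\<lambda>\<omega>. B (p (Suc i)) \<omega> - B (p i) \<omega>) (normal_density 0 (sqrt (p (Suc i) - p i)))"
        using J(2)[of i] nn[of i] p(2)[of i] by (intro increment_normal) auto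
      then show "distributed M lborel (\<lambda>\<omega>. 0 + v i * (B (p (Suc i)) \<omega> - B (p i) \<omega>))
          (normal_density (0 + v i * 0) (\<bar>v i\<bar> * sqrt (p (Suc i) - p i)))"
        using J(2)[OF i] p(2)[of i] by (intro normal_density_affine) auto
    qed
    then have D: "distributed M lborel ?S (normal_density 0 sd)" by simp
    have "expectation (\<lambda>\<omega>. \<bar>?S \<omega>\<bar>) = sd * sqrt (2 / pi)"
      using distributed_integral[OF D, of "\<lambda>x. \<bar>x\<bar>"] integral_normal_moment_abs_odd[OF sd, of 0 0] by simp
    moreover have "expectation (\<lambda>\<omega>. (?S \<omega>)\<^sup>2) = sd\<^sup>2"
      using normal_distributed_variance[OF sd D] normal_distributed_expectation[OF sd D] by simp
    ultimately show ?thesis using sd by simp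
  qed (simp add: SJ)
  then show ?thesis by (simp add: sq)
qed

text \<open>Doob's inequality for a step integrand at finitely many times: the times in \<open>G\<close> are merged with the
partition points into one grid.\<close>

lemma truncated_integral_maximal_inequality:
  assumes p: "p 0 = 0" "p N = T" "\<And>i. i < N \<Longrightarrow> p i < p (Suc i)"
    and G: "finite G" "G \<subseteq> {0..T}" and "0 \<le> \<rho>"
  shows "\<rho> * prob {\<omega> \<in> space M. \<exists>t\<in>G. \<rho> < \<bar>truncated_integral N p v t \<omega>\<bar>}
    \<le> sqrt (2 / pi) * sqrt (\<integral>s. (step_fun N p v s)\<^sup>2 \<partial>lborel)"
proof -
  let ?X = "truncated_integral N p v"
  define P where "P = p ` {..N} \<union> G"
  have pm: "i \<le> j \<Longrightarrow> j \<le> N \<Longrightarrow> p i \<le> p j" for i j using partition_mono[of N p i j] p by auto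
  have P: "finite P" "P \<noteq> {}" using G by (auto simp: P_def)
  obtain r :: "nat \<Rightarrow> real" and L where r: "r ` {..L} = P" "\<And>i j. i < j \<Longrightarrow> j \<le> L \<Longrightarrow> r i < r j"
    using finite_set_increasing_enumeration[OF P] by blast
  have P0T: "P \<subseteq> {0..T}" using G pm[of 0] pm[of _ N] p by (auto simp: P_def)
  have rle: "r i \<le> r j" if "i \<le> j" "j \<le> L" for i j
    using r(2)[of i j] that by (cases "i = j") auto
  have r0: "0 \<le> r 0" using r(1) P0T by auto
  define c where "c l = step_fun N p v (r (Suc l))" for l
  have X: "?X (r m) \<omega> = (\<Sum>l<m. c l * (B (r (Suc l)) \<omega> - B (r l) \<omega>))" if "m \<le> L" for m \<omega>
    unfolding truncated_integral_def c_def
    by (rule truncated_step_sum_on_grid[where b="\<lambda>t. B t \<omega>", OF r(2) that])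
       (use r(1) p(3) in \<open>auto simp: P_def intro: less_imp_le\<close>)
  have "T \<in> P" using p by (auto simp: P_def)
  then obtain m where m: "m \<le> L" "r m = T" using r(1) by auto
  have "r L \<in> P" using r(1) by auto
  then have "r L = T" using P0T m rle[of m L] by force
  then have XL: "(\<Sum>l<L. c l * (B (r (Suc l)) \<omega> - B (r l) \<omega>)) = step_integral B N p v \<omega>" for \<omega>
    using X[of L \<omega>] pm[of _ N] p(2) by (auto simp: truncated_integral_def step_integral_def min_absorb1)
  have rn: "0 \<le> r i" if "i \<le> L" for i using rle[of 0 i] that r0 by simp
  have mom: "integrable M (\<lambda>\<omega>. B (r (Suc i)) \<omega> - B (r i) \<omega>)"
      "expectation (\<lambda>\<omega>. B (r (Suc i)) \<omega> - B (r i) \<omega>) = 0" if "i < L" for i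
    using increment_moments[of "r i" "r (Suc i)"] that rn[of i] rle[of i "Suc i"] by auto
  have "indep_vars (\<lambda>_. borel) (\<lambda>i \<omega>. B (r (Suc i)) \<omega> - B (r i) \<omega>) {..<L}"
    using r0 r(2) by (intro increments_indep) auto
  then have ind: "indep_vars (\<lambda>_. borel) (\<lambda>i \<omega>. c i * (B (r (Suc i)) \<omega> - B (r i) \<omega>)) {..<L}"
    by (rule indep_vars_compose2) simp
  have meas: "(\<lambda>\<omega>. \<Sum>l<j. c l * (B (r (Suc l)) \<omega> - B (r l) \<omega>)) \<in> borel_measurable M" if "j \<le> L" for j
    using that rn by (intro borel_measurable_sum borel_measurable_times borel_measurable_diff measurable_B) auto
  have ev: "{\<omega> \<in> space M. \<exists>j\<le>L. \<rho> < \<bar>\<Sum>l<j. c l * (B (r (Suc l)) \<omega> - B (r l) \<omega>)\<bar>} \<in> sets M"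
    using sets_exceeds[of "{..L}" "\<lambda>j \<omega>. \<Sum>l<j. c l * (B (r (Suc l)) \<omega> - B (r l) \<omega>)" M "\<lambda>_. \<rho>"] meas
    by (simp add: Bex_def)
  have "\<exists>j\<le>L. \<rho> < \<bar>\<Sum>l<j. c l * (B (r (Suc l)) \<omega> - B (r l) \<omega>)\<bar>"
    if "t \<in> G" "\<rho> < \<bar>?X t \<omega>\<bar>" for t \<omega>
  proof -
    have "t \<in> r ` {..L}" using \<open>t \<in> G\<close> unfolding r(1) P_def by (rule UnI2)
    then obtain j where "j \<le> L" "t = r j" by auto
    then show ?thesis using X[of j \<omega>] that(2) by auto
  qed
  then have sub: "{\<omega> \<in> space M. \<exists>t\<in>G. \<rho> < \<bar>?X t \<omega>\<bar>}
      \<subseteq> {\<omega> \<in> space M. \<exists>j\<le>L. \<rho> < \<bar>\<Sum>l<j. c l * (B (r (Suc l)) \<omega> - B (r l) \<omega>)\<bar>}"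
    by blast
  have "\<rho> * prob {\<omega> \<in> space M. \<exists>t\<in>G. \<rho> < \<bar>?X t \<omega>\<bar>}
      \<le> \<rho> * prob {\<omega> \<in> space M. \<exists>j\<le>L. \<rho> < \<bar>\<Sum>l<j. c l * (B (r (Suc l)) \<omega> - B (r l) \<omega>)\<bar>}"
    by (rule mult_left_mono[OF finite_measure_mono[OF sub ev] \<open>0 \<le> \<rho>\<close>])
  also have "\<dots> \<le> expectation (\<lambda>\<omega>. \<bar>\<Sum>l<L. c l * (B (r (Suc l)) \<omega> - B (r l) \<omega>)\<bar>)"
    using mom \<open>0 \<le> \<rho>\<close> by (intro maximal_inequality_indep_sums[OF ind]) auto
  also have "\<dots> = sqrt (2 / pi) * sqrt (\<integral>s. (step_fun N p v s)\<^sup>2 \<partial>lborel)"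
    unfolding XL using p by (intro step_integral_abs_moment) auto
  finally show ?thesis .
qed

end

section \<open>Maximal inequality for Wiener integrals\<close>

lemma L2_tendsto_D:
  assumes "L2_tendsto N X Y"
  shows "X k \<in> borel_measurable N" "integrable N (\<lambda>z. (X k z)\<^sup>2)"
    and "Y \<in> borel_measurable N" "integrable N (\<lambda>z. (Y z)\<^sup>2)"
    and "(\<lambda>k. \<integral>z. (X k z - Y z)\<^sup>2 \<partial>N) \<longlonglongrightarrow> 0"
  using assms unfolding L2_tendsto_def by blast+

text \<open>When \<open>X\<close> runs through a sequence converging to \<open>Y\<close> in \<open>L\<^sup>2\<close> and \<open>\<delta>\<close> tends to zero afterwards, this bounds
the norms of the approximations asymptotically by the norm of the limit.\<close>

lemma integral_square_weighted:
  fixes X Y :: "'b \<Rightarrow> real"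
  assumes "X \<in> borel_measurable N" "Y \<in> borel_measurable N"
    and "integrable N (\<lambda>z. (X z)\<^sup>2)" "integrable N (\<lambda>z. (Y z)\<^sup>2)" and "0 < \<delta>"
  shows "(\<integral>z. (X z)\<^sup>2 \<partial>N) \<le> (1 + \<delta>) * (\<integral>z. (Y z)\<^sup>2 \<partial>N) + (1 + 1 / \<delta>) * (\<integral>z. (X z - Y z)\<^sup>2 \<partial>N)"
proof -
  have "x\<^sup>2 \<le> (1 + \<delta>) * y\<^sup>2 + (1 + 1 / \<delta>) * (x - y)\<^sup>2" for x y :: real
  proof -
    \<comment> \<open>Young's inequality, obtained by completing the square.\<close>
    have "0 \<le> (\<delta> * y - (x - y))\<^sup>2 / \<delta>" using \<open>0 < \<delta>\<close> by simp
    also have "\<dots> = (1 + \<delta>) * y\<^sup>2 + (1 + 1 / \<delta>) * (x - y)\<^sup>2 - x\<^sup>2"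
      using \<open>0 < \<delta>\<close> by (simp add: field_simps power2_eq_square)
    finally show ?thesis by simp
  qed
  then have "(\<integral>z. (X z)\<^sup>2 \<partial>N) \<le> (\<integral>z. (1 + \<delta>) * (Y z)\<^sup>2 + (1 + 1 / \<delta>) * (X z - Y z)\<^sup>2 \<partial>N)"
    using assms integrable_square_diff[OF assms(1-4)] by (intro integral_mono) auto
  also have "\<dots> = (1 + \<delta>) * (\<integral>z. (Y z)\<^sup>2 \<partial>N) + (1 + 1 / \<delta>) * (\<integral>z. (X z - Y z)\<^sup>2 \<partial>N)"
    using assms integrable_square_diff[OF assms(1-4)] by simp
  finally show ?thesis .
qed

abbreviation lborel_upto :: "real \<Rightarrow> real measure" where
  "lborel_upto t \<equiv> restrict_space lborel {0..t}"

lemma step_fun_borel: "step_fun N p v \<in> borel_measurable borel"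
  unfolding step_fun_def[abs_def] by measurable

lemma integral_upto_eq:
  fixes g :: "real \<Rightarrow> real"
  shows "integral\<^sup>L (lborel_upto t) g = (\<integral>s. indicator {0..t} s * g s \<partial>lborel)"
  by (subst integral_restrict_space) auto

lemma integrable_upto_iff:
  fixes g :: "real \<Rightarrow> real"
  shows "integrable (lborel_upto t) g \<longleftrightarrow> integrable lborel (\<lambda>s. indicator {0..t} s * g s)"
  by (subst integrable_restrict_space) auto

lemma integral_upto:
  fixes g :: "real \<Rightarrow> real"
  assumes "\<And>s. s \<notin> {0..t} \<Longrightarrow> g s = 0"
  shows "integral\<^sup>L lborel g = integral\<^sup>L (lborel_upto t) g"
proof -
  have "(\<lambda>s. indicator {0..t} s * g s) = g" using assms by (auto simp: fun_eq_iff indicator_def)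
  then show ?thesis by (simp only: integral_upto_eq)
qed

lemma integrable_upto_mono:
  fixes g :: "real \<Rightarrow> real"
  assumes "integrable (lborel_upto T) g" "t \<le> T"
  shows "integrable (lborel_upto t) g"
proof -
  have "integrable lborel (\<lambda>s. indicator {0..t} s *\<^sub>R (indicator {0..T} s * g s))"
    using assms(1) unfolding integrable_upto_iff by (rule integrable_mult_indicator[rotated]) simp
  also have "(\<lambda>s. indicator {0..t} s *\<^sub>R (indicator {0..T} s * g s)) = (\<lambda>s. indicator {0..t} s * g s)"
    using assms(2) by (auto simp: fun_eq_iff indicator_def)
  finally show ?thesis unfolding integrable_upto_iff .
qed

lemma integral_upto_mono:
  fixes g :: "real \<Rightarrow> real"
  assumes g: "integrable (lborel_upto T) g" "\<And>s. 0 \<le> g s" and "t \<le> T"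
  shows "integral\<^sup>L (lborel_upto t) g \<le> integral\<^sup>L (lborel_upto T) g"
  unfolding integral_upto_eq
proof (rule integral_mono)
  show "indicator {0..t} s * g s \<le> indicator {0..T} s * g s" for s
    using g(2)[of s] \<open>t \<le> T\<close> by (auto simp: indicator_def)
qed (use g(1) integrable_upto_mono[OF g(1) \<open>t \<le> T\<close>] in \<open>simp_all only: integrable_upto_iff\<close>)

lemma step_fun_outside:
  assumes p: "p 0 = 0" "p N = t" "\<And>i. i < N \<Longrightarrow> p i < p (Suc i)" and "s \<notin> {0..t}"
  shows "step_fun N p v s = 0"
proof -
  have "s \<notin> {p i<..p (Suc i)}" if "i < N" for i
    using partition_mono[of N p 0 i] partition_mono[of N p "Suc i" N] p assms(4) that by auto
  then show ?thesis by (simp add: step_fun_def)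
qed

lemma rationals_dense_interval:
  fixes T :: real
  assumes "0 < T"
  shows "{0..T} \<subseteq> closure (\<rat> \<inter> {0..T})"
proof -
  have "{0..T} = closure {0<..<T}" using assms by simp
  also have "\<dots> = closure ({0<..<T} \<inter> \<rat>)"
    by (rule closure_open_Int_superset[symmetric]) (auto simp: Rats_closure_real)
  also have "\<dots> \<subseteq> closure (\<rat> \<inter> {0..T})" by (intro closure_mono) auto
  finally show ?thesis .
qed

lemma continuous_le_from_rationals:
  fixes g :: "real \<Rightarrow> real"
  assumes "0 < T" "continuous_on {0..T} g" "\<And>t. t \<in> \<rat> \<inter> {0..T} \<Longrightarrow> g t \<le> b" "t \<in> {0..T}"
  shows "g t \<le> b"
proof -
  have "closure (\<rat> \<inter> {0..T}) = {0..T}"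
    using rationals_dense_interval[OF assms(1)] closure_minimal[of "\<rat> \<inter> {0..T}" "{0..T}"] by auto
  then show ?thesis using continuous_le_on_closure[of "\<rat> \<inter> {0..T}" g t b] assms by auto
qed

context brownian_motion
begin

text \<open>Mean-square distance of two step integrals up to time \<open>t\<close>, the second stopped there, in terms of the
integrands.\<close>

lemma truncated_integral_step_distance:
  assumes p: "p 0 = 0" "p N = T" "\<And>i. i < N \<Longrightarrow> p i < p (Suc i)"
    and q: "q 0 = 0" "q N' = t" "\<And>i. i < N' \<Longrightarrow> q i < q (Suc i)"
    and t: "0 \<le> t" "t \<le> T"
  shows "expectation (\<lambda>\<omega>. (step_integral B N' q u \<omega> - truncated_integral N p v t \<omega>)\<^sup>2)
    = (\<integral>s. (step_fun N' q u s - step_fun N p v s)\<^sup>2 \<partial>lborel_upto t)"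
proof -
  have pn: "0 \<le> p i \<and> p i \<le> p (Suc i)" if "i < N" for i
    using partition_mono[of N p 0 i] p that by (auto intro: less_imp_le)
  have qn: "0 \<le> q i \<and> q i \<le> q (Suc i)" if "i < N'" for i
    using partition_mono[of N' q 0 i] q that by (auto intro: less_imp_le)
  \<comment> \<open>The integrand of the stopped integral: the step function cut off at \<open>t\<close>.\<close>
  define h where "h s = (\<Sum>i<N. v i * indicator {min (p i) t<..min (p (Suc i)) t} s)" for s
  have h: "h s = (if s \<le> t then step_fun N p v s else 0)" for s
    unfolding h_def step_fun_def by (auto simp: indicator_def intro!: sum.cong sum.neutral)
  have "expectation (\<lambda>\<omega>. (step_integral B N' q u \<omega> - truncated_integral N p v t \<omega>)\<^sup>2)
      = (\<integral>s. (step_fun N' q u s - h s)\<^sup>2 \<partial>lborel)"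
    unfolding step_integral_def truncated_integral_def step_fun_def h_def
    using pn qn t by (intro wiener_isometry_diff) (auto simp: min.coboundedI1)
  also have "\<dots> = (\<integral>s. (step_fun N' q u s - h s)\<^sup>2 \<partial>lborel_upto t)"
    using step_fun_outside[of q N' t, OF q] step_fun_outside[of p N T, OF p] t
    by (intro integral_upto) (auto simp: h)
  also have "\<dots> = (\<integral>s. (step_fun N' q u s - step_fun N p v s)\<^sup>2 \<partial>lborel_upto t)"
    by (intro Bochner_Integration.integral_cong) (auto simp: h space_restrict_space)
  finally show ?thesis .
qed

lemma truncated_integral_square_integrable:
  assumes p: "p 0 = 0" "\<And>i. i < N \<Longrightarrow> p i < p (Suc i)" and t: "0 \<le> t"
  shows "truncated_integral N p v t \<in> borel_measurable M"
    and "integrable M (\<lambda>\<omega>. (truncated_integral N p v t \<omega>)\<^sup>2)"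
proof -
  have pn: "0 \<le> p i \<and> p i \<le> p (Suc i)" if "i < N" for i
    using partition_mono[of N p 0 i] p that by (auto intro: less_imp_le)
  then have pn': "0 \<le> p (Suc i)" if "i < N" for i using that by force
  show "truncated_integral N p v t \<in> borel_measurable M"
    unfolding truncated_integral_def[abs_def] using pn pn' t
    by (intro borel_measurable_sum borel_measurable_times borel_measurable_diff measurable_B) auto
  show "integrable M (\<lambda>\<omega>. (truncated_integral N p v t \<omega>)\<^sup>2)"
    unfolding truncated_integral_def using pn t by (intro wiener_isometry) (auto simp: min.coboundedI1)
qed

text \<open>The integral over \<open>[0, t]\<close> is defined through its own step functions on \<open>[0, t]\<close>. By the isometry the
restrictions to \<open>[0, t]\<close> of the step functions used on \<open>[0, T]\<close> do equally well. Hence a single sequence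
of step functions approximates the integral process at all times.\<close>

lemma truncated_integral_tendsto:
  assumes p: "\<And>k. p k 0 = 0 \<and> p k (N k) = T \<and> (\<forall>i<N k. p k i < p k (Suc i))"
    and h: "L2_tendsto (lborel_upto T) (\<lambda>k. step_fun (N k) (p k) (v k)) f"
    and t: "0 \<le> t" "t \<le> T" and I: "is_wiener_integral M B f t I"
  shows "(\<lambda>k. expectation (\<lambda>\<omega>. (I \<omega> - truncated_integral (N k) (p k) (v k) t \<omega>)\<^sup>2)) \<longlonglongrightarrow> 0"
proof -
  obtain N' q u where q: "\<And>k. q k 0 = 0 \<and> q k (N' k) = t \<and> (\<forall>i<N' k. q k i < q k (Suc i))"
    and g: "L2_tendsto (lborel_upto t) (\<lambda>k. step_fun (N' k) (q k) (u k)) f"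
    and S: "L2_tendsto M (\<lambda>k. step_integral B (N' k) (q k) (u k)) I"
    using I unfolding is_wiener_integral_def by auto
  let ?h = "\<lambda>k. step_fun (N k) (p k) (v k)" and ?g = "\<lambda>k. step_fun (N' k) (q k) (u k)"
  let ?S = "\<lambda>k. step_integral B (N' k) (q k) (u k)" and ?X = "\<lambda>k. truncated_integral (N k) (p k) (v k) t"
  note hD = L2_tendsto_D[OF h] and gD = L2_tendsto_D[OF g] and SD = L2_tendsto_D[OF S]
  note X = truncated_integral_square_integrable[of "p k" "N k" t "v k" for k]
  let ?bound = "\<lambda>k. 2 * (\<integral>\<omega>. (?S k \<omega> - I \<omega>)\<^sup>2 \<partial>M)
    + 2 * (2 * (\<integral>s. (?g k s - f s)\<^sup>2 \<partial>lborel_upto t) + 2 * (\<integral>s. (?h k s - f s)\<^sup>2 \<partial>lborel_upto T))"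
  have hm: "?h k \<in> borel_measurable (lborel_upto t)" for k
    by (intro measurable_restrict_space1) (simp add: step_fun_borel)
  have le: "expectation (\<lambda>\<omega>. (I \<omega> - ?X k \<omega>)\<^sup>2) \<le> ?bound k" for k
  proof -
    have "expectation (\<lambda>\<omega>. (I \<omega> - ?X k \<omega>)\<^sup>2)
        \<le> 2 * expectation (\<lambda>\<omega>. (I \<omega> - ?S k \<omega>)\<^sup>2) + 2 * expectation (\<lambda>\<omega>. (?S k \<omega> - ?X k \<omega>)\<^sup>2)"
      using SD X[of k] p[of k] t by (intro integral_square_triangle) auto
    also have "expectation (\<lambda>\<omega>. (I \<omega> - ?S k \<omega>)\<^sup>2) = expectation (\<lambda>\<omega>. (?S k \<omega> - I \<omega>)\<^sup>2)"
      by (simp add: power2_commute)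
    also have "expectation (\<lambda>\<omega>. (?S k \<omega> - ?X k \<omega>)\<^sup>2) = (\<integral>s. (?g k s - ?h k s)\<^sup>2 \<partial>lborel_upto t)"
      using p[of k] q[of k] t by (intro truncated_integral_step_distance) auto
    also have "\<dots> \<le> 2 * (\<integral>s. (?g k s - f s)\<^sup>2 \<partial>lborel_upto t) + 2 * (\<integral>s. (f s - ?h k s)\<^sup>2 \<partial>lborel_upto t)"
      using gD hD integrable_upto_mono[OF hD(2)[of k] t(2)] hm
      by (intro integral_square_triangle) auto
    also have "(\<integral>s. (f s - ?h k s)\<^sup>2 \<partial>lborel_upto t) = (\<integral>s. (?h k s - f s)\<^sup>2 \<partial>lborel_upto t)"
      by (simp add: power2_commute)
    also have "\<dots> \<le> (\<integral>s. (?h k s - f s)\<^sup>2 \<partial>lborel_upto T)"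
      using hD t by (intro integral_upto_mono integrable_square_diff) auto
    finally show ?thesis by simp
  qed
  have "?bound \<longlonglongrightarrow> 2 * 0 + 2 * (2 * 0 + 2 * 0)"
    by (intro tendsto_intros hD(5) gD(5) SD(5))
  then have "?bound \<longlonglongrightarrow> 0" by simp
  show ?thesis
  proof (rule tendsto_sandwich)
    show "\<forall>\<^sub>F k in sequentially. 0 \<le> expectation (\<lambda>\<omega>. (I \<omega> - ?X k \<omega>)\<^sup>2)" by simp
    show "\<forall>\<^sub>F k in sequentially. expectation (\<lambda>\<omega>. (I \<omega> - ?X k \<omega>)\<^sup>2) \<le> ?bound k"
      by (intro always_eventually allI le)
  qed (use \<open>?bound \<longlonglongrightarrow> 0\<close> in simp_all)
qed

text \<open>If \<open>\<bar>I\<^sub>t\<bar> > \<rho>\<close>, then either the approximating step integral exceeds \<open>\<rho> - \<delta>\<close>, which is covered by the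
inequality for step integrands, or it differs from \<open>I\<^sub>t\<close> by at least \<open>\<delta>\<close>, whose probability tends to zero by
Chebyshev's inequality. The limit along the sequence is followed by \<open>\<delta> \<rightarrow> 0\<close>.\<close>

lemma wiener_integral_maximal_inequality_finite:
  assumes I: "\<And>t. 0 \<le> t \<Longrightarrow> is_wiener_integral M B f t (I t)" and "0 \<le> T"
    and G: "finite G" "G \<subseteq> {0..T}" and "0 < \<rho>"
  shows "\<rho> * prob {\<omega> \<in> space M. \<exists>t\<in>G. \<rho> < \<bar>I t \<omega>\<bar>} \<le> sqrt (2 / pi) * sqrt (\<integral>s. (f s)\<^sup>2 \<partial>lborel_upto T)"
proof -
  let ?F = "\<integral>s. (f s)\<^sup>2 \<partial>lborel_upto T" and ?P = "prob {\<omega> \<in> space M. \<exists>t\<in>G. \<rho> < \<bar>I t \<omega>\<bar>}"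
  obtain N p v where p: "\<And>k. p k 0 = 0 \<and> p k (N k) = T \<and> (\<forall>i<N k. p k i < p k (Suc i))"
    and h: "L2_tendsto (lborel_upto T) (\<lambda>k. step_fun (N k) (p k) (v k)) f"
    using I[OF \<open>0 \<le> T\<close>] unfolding is_wiener_integral_def by auto
  let ?h = "\<lambda>k. step_fun (N k) (p k) (v k)" and ?X = "\<lambda>k t. truncated_integral (N k) (p k) (v k) t"
  note hD = L2_tendsto_D[OF h]
  note X = truncated_integral_square_integrable[of "p k" "N k" t "v k" for k t]
  have Isq: "I t \<in> borel_measurable M" "integrable M (\<lambda>\<omega>. (I t \<omega>)\<^sup>2)" if "0 \<le> t" for t
    using I[OF that] by (auto simp: is_wiener_integral_def L2_tendsto_def)
  define e where "e k t = expectation (\<lambda>\<omega>. (I t \<omega> - ?X k t \<omega>)\<^sup>2)" for k t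
  have e: "(\<lambda>k. e k t) \<longlonglongrightarrow> 0" if "t \<in> G" for t
    unfolding e_def using that G by (intro truncated_integral_tendsto[OF p h] I) auto
  define d where "d k = (\<integral>s. (?h k s - f s)\<^sup>2 \<partial>lborel_upto T)" for k
  have d: "d \<longlonglongrightarrow> 0" using hD(5) by (simp add: d_def[abs_def])
  have bound: "(\<rho> - \<delta>) * ?P \<le> sqrt (2 / pi) * sqrt ((1 + \<delta>) * ?F)" if \<delta>: "0 < \<delta>" "\<delta> < \<rho>" for \<delta>
  proof -
    let ?R = "\<lambda>k. sqrt (2 / pi) * sqrt ((1 + \<delta>) * ?F + (1 + 1 / \<delta>) * d k) + (\<rho> - \<delta>) * (\<Sum>t\<in>G. e k t / \<delta>\<^sup>2)"
    have "(\<rho> - \<delta>) * ?P \<le> ?R k" for k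
    proof -
      let ?A = "{\<omega> \<in> space M. \<exists>t\<in>G. \<rho> - \<delta> < \<bar>?X k t \<omega>\<bar>}"
      let ?E = "\<lambda>t. {\<omega> \<in> space M. (I t \<omega> - ?X k t \<omega>)\<^sup>2 \<ge> \<delta>\<^sup>2}"
      have Xm: "?X k t \<in> borel_measurable M" "integrable M (\<lambda>\<omega>. (?X k t \<omega>)\<^sup>2)" if "t \<in> G" for t
        using X[of k t] p[of k] G that by auto
      have IX: "integrable M (\<lambda>\<omega>. (I t \<omega> - ?X k t \<omega>)\<^sup>2)" if "t \<in> G" for t
        using Isq[of t] Xm[OF that] G that by (intro integrable_square_diff) auto
      have A: "?A \<in> sets M" using Xm G(1) by (intro sets_exceeds countable_finite) auto
      have E: "?E t \<in> sets M" if "t \<in> G" for t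
      proof -
        have [measurable]: "(\<lambda>\<omega>. (I t \<omega> - ?X k t \<omega>)\<^sup>2) \<in> borel_measurable M" using IX[OF that] by simp
        show ?thesis by measurable
      qed
      have EU: "(\<Union>t\<in>G. ?E t) \<in> sets M" using E G(1) by (intro sets.finite_UN) auto
      have close: "\<omega> \<in> ?E t \<or> \<rho> - \<delta> < \<bar>?X k t \<omega>\<bar>" if "\<omega> \<in> space M" "\<rho> < \<bar>I t \<omega>\<bar>" for t \<omega>
      proof (rule disjCI)
        assume "\<not> \<rho> - \<delta> < \<bar>?X k t \<omega>\<bar>"
        then have "\<bar>\<delta>\<bar> \<le> \<bar>I t \<omega> - ?X k t \<omega>\<bar>" using that(2) \<delta> by linarith
        then show "\<omega> \<in> ?E t" using that(1) by (simp add: abs_le_square_iff)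
      qed
      then have sub: "{\<omega> \<in> space M. \<exists>t\<in>G. \<rho> < \<bar>I t \<omega>\<bar>} \<subseteq> ?A \<union> (\<Union>t\<in>G. ?E t)" by blast
      have "?P \<le> prob (?A \<union> (\<Union>t\<in>G. ?E t))"
        by (intro finite_measure_mono sub sets.Un A EU)
      also have "\<dots> \<le> prob ?A + prob (\<Union>t\<in>G. ?E t)"
        by (intro measure_Un_le A EU)
      also have "prob (\<Union>t\<in>G. ?E t) \<le> (\<Sum>t\<in>G. prob (?E t))"
        using E G(1) by (intro measure_UNION_le) auto
      also have "\<dots> \<le> (\<Sum>t\<in>G. e k t / \<delta>\<^sup>2)"
        unfolding e_def using IX \<delta>(1)
        by (intro sum_mono integral_Markov_inequality_measure[where A="{}"]) auto
      finally have "(\<rho> - \<delta>) * ?P \<le> (\<rho> - \<delta>) * prob ?A + (\<rho> - \<delta>) * (\<Sum>t\<in>G. e k t / \<delta>\<^sup>2)"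
        using \<delta> by (simp add: distrib_left[symmetric])
      also have "(\<rho> - \<delta>) * prob ?A \<le> sqrt (2 / pi) * sqrt (\<integral>s. (?h k s)\<^sup>2 \<partial>lborel)"
        using p[of k] G \<delta> by (intro truncated_integral_maximal_inequality) auto
      also have "(\<integral>s. (?h k s)\<^sup>2 \<partial>lborel) = (\<integral>s. (?h k s)\<^sup>2 \<partial>lborel_upto T)"
        using p[of k] by (intro integral_upto) (auto simp: step_fun_outside[where t=T])
      also have "sqrt (2 / pi) * sqrt \<dots> \<le> sqrt (2 / pi) * sqrt ((1 + \<delta>) * ?F + (1 + 1 / \<delta>) * d k)"
        unfolding d_def using \<delta> hD
        by (intro mult_left_mono real_sqrt_le_mono integral_square_weighted) auto
      finally show ?thesis by simp
    qed
    moreover have "?R \<longlonglongrightarrow> sqrt (2 / pi) * sqrt ((1 + \<delta>) * ?F + (1 + 1 / \<delta>) * 0) + (\<rho> - \<delta>) * (\<Sum>t\<in>G. 0 / \<delta>\<^sup>2)"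
      using \<delta> by (intro tendsto_intros d e) auto
    ultimately show ?thesis by (intro LIMSEQ_le_const) auto
  qed
  have "((\<lambda>\<delta>. (\<rho> - \<delta>) * ?P) \<longlongrightarrow> (\<rho> - 0) * ?P) (at_right 0)"
    by (intro tendsto_intros)
  moreover have "((\<lambda>\<delta>. sqrt (2 / pi) * sqrt ((1 + \<delta>) * ?F)) \<longlongrightarrow> sqrt (2 / pi) * sqrt ((1 + 0) * ?F)) (at_right 0)"
    by (intro tendsto_intros)
  moreover have "\<forall>\<^sub>F \<delta> in at_right 0. (\<rho> - \<delta>) * ?P \<le> sqrt (2 / pi) * sqrt ((1 + \<delta>) * ?F)"
    unfolding eventually_at_right_field using bound \<open>0 < \<rho>\<close> by blast
  ultimately have "(\<rho> - 0) * ?P \<le> sqrt (2 / pi) * sqrt ((1 + 0) * ?F)"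
    by (intro tendsto_le[of "at_right 0"]) auto
  then show ?thesis by simp
qed

text \<open>Continuity of measure along an increasing sequence of finite sets of times that exhausts the
rationals in \<open>[0, T]\<close>. For continuous paths this set of times is as good as the whole interval.\<close>

theorem wiener_integral_maximal_inequality:
  assumes I: "\<And>t. 0 \<le> t \<Longrightarrow> is_wiener_integral M B f t (I t)"
    and "0 < T" and "0 < \<rho>"
  shows "\<rho> * prob {\<omega> \<in> space M. \<exists>t\<in>\<rat> \<inter> {0..T}. \<rho> < \<bar>I t \<omega>\<bar>}
    \<le> sqrt (2 / pi) * sqrt (\<integral>s. (f s)\<^sup>2 \<partial>lborel_upto T)"
proof -
  let ?D = "\<rat> \<inter> {0..T}"
  have cD: "countable ?D" by (intro countable_Int1 countable_rat)
  have "0 \<in> ?D" using \<open>0 < T\<close> by auto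
  then have D: "range (from_nat_into ?D) = ?D"
    using cD by (intro range_from_nat_into) auto
  define G where "G n = from_nat_into ?D ` {..n}" for n
  have "(\<Union>n. G n) = range (from_nat_into ?D)" unfolding G_def by blast
  then have GD: "(\<Union>n. G n) = ?D" by (simp only: D)
  have G: "finite (G n)" "G n \<subseteq> {0..T}" for n using GD by (auto simp: G_def)
  define A where "A n = {\<omega> \<in> space M. \<exists>t\<in>G n. \<rho> < \<bar>I t \<omega>\<bar>}" for n
  have Im: "I t \<in> borel_measurable M" if "0 \<le> t" for t
    using I[OF that] by (auto simp: is_wiener_integral_def L2_tendsto_def)
  have "A n \<in> sets M" for n
    unfolding A_def using G[of n] Im by (intro sets_exceeds countable_finite) auto
  moreover have "incseq A" by (auto simp: incseq_def A_def G_def)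
  ultimately have "(\<lambda>n. prob (A n)) \<longlonglongrightarrow> prob (\<Union>n. A n)"
    by (intro finite_Lim_measure_incseq) auto
  then have "(\<lambda>n. \<rho> * prob (A n)) \<longlonglongrightarrow> \<rho> * prob (\<Union>n. A n)" by (intro tendsto_intros)
  moreover have "\<rho> * prob (A n) \<le> sqrt (2 / pi) * sqrt (\<integral>s. (f s)\<^sup>2 \<partial>lborel_upto T)" for n
    unfolding A_def using G \<open>0 < T\<close> \<open>0 < \<rho>\<close>
    by (intro wiener_integral_maximal_inequality_finite[where I=I] I) auto
  ultimately have "\<rho> * prob (\<Union>n. A n) \<le> sqrt (2 / pi) * sqrt (\<integral>s. (f s)\<^sup>2 \<partial>lborel_upto T)"
    by (intro LIMSEQ_le_const2) auto
  moreover have "(\<Union>n. A n) = {\<omega> \<in> space M. \<exists>t\<in>?D. \<rho> < \<bar>I t \<omega>\<bar>}"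
    unfolding A_def GD[symmetric] by blast
  ultimately show ?thesis by simp
qed

end

section \<open>Continuity of the Jacobi elliptic functions and of the fundamental solutions\<close>

lemma LBINT_has_real_derivative:
  fixes g :: "real \<Rightarrow> real"
  assumes "continuous_on UNIV g"
  shows "((\<lambda>u. LBINT y=0..ereal u. g y) has_real_derivative g x) (at x)"
proof -
  let ?R = "\<bar>x\<bar> + 1"
  have "((\<lambda>u. LBINT y=ereal 0..ereal u. g y) has_vector_derivative g x) (at x within {-?R..?R})"
    by (rule interval_integral_FTC2) (auto intro: continuous_on_subset[OF assms])
  then have "((\<lambda>u. LBINT y=ereal 0..ereal u. g y) has_vector_derivative g x) (at x within {-?R<..<?R})"
    by (rule has_vector_derivative_within_subset) auto
  moreover have "at x within {-?R<..<?R} = at x" by (rule at_within_open) auto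
  ultimately show ?thesis
    by (simp add: has_real_derivative_iff_has_vector_derivative zero_ereal_def)
qed

lemma LBINT_continuous:
  fixes g :: "real \<Rightarrow> real"
  assumes "continuous_on UNIV g"
  shows "continuous_on UNIV (\<lambda>u. LBINT y=0..ereal u. g y)"
  using LBINT_has_real_derivative[OF assms] by (intro DERIV_continuous_on) auto

context
  fixes q :: real
  assumes q: "q\<^sup>2 < 1"
begin

lemma modulus_sin_less_1: "q\<^sup>2 * (sin \<alpha>)\<^sup>2 < 1"
proof -
  have "(sin \<alpha>)\<^sup>2 \<le> 1" by (simp add: abs_square_le_1)
  then have "q\<^sup>2 * (sin \<alpha>)\<^sup>2 \<le> q\<^sup>2 * 1" by (intro mult_left_mono) auto
  then show ?thesis using q by simp
qed

lemma elliptic_integrand: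
  "continuous_on UNIV (\<lambda>\<alpha>. 1 / sqrt (1 - q\<^sup>2 * (sin \<alpha>)\<^sup>2))"
  "1 \<le> 1 / sqrt (1 - q\<^sup>2 * (sin \<alpha>)\<^sup>2)"
proof -
  show "continuous_on UNIV (\<lambda>\<alpha>. 1 / sqrt (1 - q\<^sup>2 * (sin \<alpha>)\<^sup>2))"
    using modulus_sin_less_1 by (intro continuous_intros) (auto simp: less_imp_neq)
  have "0 < sqrt (1 - q\<^sup>2 * (sin \<alpha>)\<^sup>2)" "sqrt (1 - q\<^sup>2 * (sin \<alpha>)\<^sup>2) \<le> 1"
    using modulus_sin_less_1[of \<alpha>] by auto
  then show "1 \<le> 1 / sqrt (1 - q\<^sup>2 * (sin \<alpha>)\<^sup>2)" by (simp add: field_simps)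
qed

text \<open>The integrand of the elliptic integral is at least \<open>1\<close>.\<close>

lemma elliptic_F_expanding:
  assumes "\<gamma> \<le> \<delta>"
  shows "\<delta> - \<gamma> \<le> elliptic_F \<delta> q - elliptic_F \<gamma> q"
proof -
  have "elliptic_F \<gamma> q - \<gamma> \<le> elliptic_F \<delta> q - \<delta>"
  proof (rule DERIV_nonneg_imp_nondecreasing[OF assms])
    fix x
    have "((\<lambda>\<gamma>. elliptic_F \<gamma> q - \<gamma>) has_real_derivative 1 / sqrt (1 - q\<^sup>2 * (sin x)\<^sup>2) - 1) (at x)"
      unfolding elliptic_F_def
      by (intro DERIV_diff LBINT_has_real_derivative elliptic_integrand DERIV_ident)
    then show "\<exists>y. ((\<lambda>\<gamma>. elliptic_F \<gamma> q - \<gamma>) has_real_derivative y) (at x) \<and> 0 \<le> y"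
      using elliptic_integrand(2)[of x] by force
  qed
  then show ?thesis by simp
qed

text \<open>The expansion property makes \<open>F\<close> injective, and makes \<open>F\<close> attain \<open>u\<close> between \<open>-\<bar>u\<bar>\<close> and \<open>\<bar>u\<bar>\<close>; hence
the description by which the amplitude is defined denotes.\<close>

lemma elliptic_F_jacobi_am: "elliptic_F (jacobi_am u q) q = u"
proof -
  have cont: "continuous_on A (\<lambda>\<gamma>. elliptic_F \<gamma> q)" for A
    unfolding elliptic_F_def using LBINT_continuous[OF elliptic_integrand(1)]
    by (rule continuous_on_subset) simp
  have 0: "elliptic_F 0 q = 0" by (simp add: elliptic_F_def zero_ereal_def[symmetric])
  have "\<exists>\<gamma>. - \<bar>u\<bar> \<le> \<gamma> \<and> \<gamma> \<le> \<bar>u\<bar> \<and> elliptic_F \<gamma> q = u"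
    using elliptic_F_expanding[of "- \<bar>u\<bar>" 0] elliptic_F_expanding[of 0 "\<bar>u\<bar>"] 0
    by (intro IVT' cont) auto
  then obtain \<gamma> where \<gamma>: "elliptic_F \<gamma> q = u" by blast
  moreover have "\<delta> = \<gamma>" if "elliptic_F \<delta> q = u" for \<delta>
    using elliptic_F_expanding[of \<gamma> \<delta>] elliptic_F_expanding[of \<delta> \<gamma>] \<gamma> that by (cases "\<gamma> \<le> \<delta>") auto
  ultimately have "\<exists>!\<gamma>. elliptic_F \<gamma> q = u" by blast
  then show ?thesis unfolding jacobi_am_def by (rule theI')
qed

text \<open>The inverse of an expanding map is Lipschitz with constant \<open>1\<close>, which gives the continuity of all
the Jacobi functions.\<close>

lemma jacobi_am_contraction: "\<bar>jacobi_am u q - jacobi_am v q\<bar> \<le> \<bar>u - v\<bar>"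
  using elliptic_F_expanding[of "jacobi_am u q" "jacobi_am v q"]
    elliptic_F_expanding[of "jacobi_am v q" "jacobi_am u q"]
  by (cases "jacobi_am u q \<le> jacobi_am v q") (auto simp: elliptic_F_jacobi_am)

lemma continuous_on_jacobi [continuous_intros]:
  "continuous_on UNIV (\<lambda>u. jacobi_am u q)" "continuous_on UNIV (\<lambda>u. jacobi_sn u q)"
  "continuous_on UNIV (\<lambda>u. jacobi_cn u q)" "continuous_on UNIV (\<lambda>u. jacobi_dn u q)"
  "continuous_on UNIV (\<lambda>u. jacobi_Epsilon u q)"
proof -
  show am: "continuous_on UNIV (\<lambda>u. jacobi_am u q)"
    unfolding continuous_on_iff dist_real_def using jacobi_am_contraction by (meson le_less_trans UNIV_I)
  show sn: "continuous_on UNIV (\<lambda>u. jacobi_sn u q)"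
    and "continuous_on UNIV (\<lambda>u. jacobi_cn u q)"
    unfolding jacobi_sn_def jacobi_cn_def by (intro continuous_intros am)+
  show dn: "continuous_on UNIV (\<lambda>u. jacobi_dn u q)"
    unfolding jacobi_dn_def by (intro continuous_intros sn)
  show "continuous_on UNIV (\<lambda>u. jacobi_Epsilon u q)"
    unfolding jacobi_Epsilon_def by (intro LBINT_continuous continuous_intros dn)
qed

lemma continuous_on_u1: "continuous_on UNIV (u1 q)"
  unfolding u1_def[abs_def] by (intro continuous_intros)

lemma continuous_on_u2: "continuous_on UNIV (u2 q)"
  unfolding u2_def[abs_def] Let_def by (intro continuous_intros continuous_on_u1)

end

lemma continuous_on_w_sol:
  assumes "continuous_on UNIV (u (ell_modulus a c))"
  shows "continuous_on UNIV (w_sol a c y \<kappa> u)"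
  unfolding w_sol_def[abs_def]
  by (intro continuous_intros continuous_on_compose2[OF assms]) auto

lemma ell_modulus_less_1:
  assumes "2 * c + a < 0" "c < a" "- a - c < a"
  shows "(ell_modulus a c)\<^sup>2 < 1"
proof -
  have "0 \<le> (2 * c + a) / (c - a)" using assms by (intro divide_nonpos_neg) auto
  moreover have "(2 * c + a) / (c - a) < 1" using assms by (simp add: divide_less_eq)
  ultimately show ?thesis by (simp add: ell_modulus_def)
qed

section \<open>The recursion: continuity, domination and measurability\<close>

text \<open>The substitution \<open>s = t r\<close> moves the variable limit of integration into the integrand, where
continuity of parameter integrals over a fixed compact interval applies.\<close>

lemma volterra_integral_continuous:
  fixes k :: "real \<Rightarrow> real \<Rightarrow> real"
  assumes k: "continuous_on ({0..} \<times> {0..}) (\<lambda>(t, s). k t s)"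
  shows "continuous_on {0..} (\<lambda>t. LBINT s=0..ereal t. k t s)"
proof -
  have kt: "continuous_on A (k t)" if "A \<subseteq> {0..}" "0 \<le> t" for t A
    using continuous_on_compose2[OF k, of A "\<lambda>s. (t, s)"] that by (force intro: continuous_intros)
  have eq: "(LBINT s=0..ereal t. k t s) = integral (cbox 0 1) (\<lambda>r. t * k t (t * r))" if t: "0 \<le> t" for t
  proof -
    have "(LBINT r=ereal 0..ereal 1. t *\<^sub>R k t (t * r)) = (LBINT s=ereal (t * 0)..ereal (t * 1). k t s)"
      using t by (intro interval_integral_substitution_finite kt continuous_intros)
        (auto intro!: derivative_eq_intros)
    moreover have "continuous_on {0..1} (\<lambda>r. t *\<^sub>R k t (t * r))"
      using t by (intro continuous_intros continuous_on_compose2[OF kt[of "{0..}"]]) auto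
    then have "(LBINT r=ereal 0..ereal 1. t *\<^sub>R k t (t * r)) = integral {0..1} (\<lambda>r. t *\<^sub>R k t (t * r))"
      by (intro interval_integral_eq_integral borel_integrable_atLeastAtMost') auto
    ultimately show ?thesis by (simp add: zero_ereal_def)
  qed
  have "continuous_on ({0..} \<times> cbox 0 1) (\<lambda>(t, r). t * k t (t * r))"
    unfolding case_prod_beta
    by (intro continuous_intros
        continuous_on_compose2[OF k, where f="\<lambda>z. (fst z, fst z * snd z)", unfolded case_prod_beta fst_conv snd_conv])
      auto
  then have "continuous_on {0..} (\<lambda>t. integral (cbox 0 1) (\<lambda>r. t * k t (t * r)))"
    by (rule integral_continuous_on_param)
  then show ?thesis by (rule continuous_on_eq) (simp add: eq)
qed

lemma hierarchy_1: "hierarchy K f (Suc 0) t = f t"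
  by (subst hierarchy.simps) simp

lemma hierarchy_ge_2:
  "2 \<le> n \<Longrightarrow> hierarchy K f n t
    = (LBINT s=0..ereal t. K t s * (\<Sum>j\<in>{1..n-1}. hierarchy K f j s * hierarchy K f (n - j) s))"
  by (subst hierarchy.simps) simp

lemma hierarchy_continuous:
  assumes K: "continuous_on UNIV (\<lambda>(t, s). K t s)" and f: "continuous_on {0..} f" and "1 \<le> n"
  shows "continuous_on {0..} (hierarchy K f n)"
  using \<open>1 \<le> n\<close>
proof (induction n rule: less_induct)
  case (less n)
  show ?case
  proof (cases "n = 1")
    case True
    then show ?thesis using f by (simp add: hierarchy_1)
  next
    case False
    then have n: "2 \<le> n" using less.prems by simp
    have S: "continuous_on {0..} (\<lambda>s. \<Sum>j\<in>{1..n-1}. hierarchy K f j s * hierarchy K f (n - j) s)"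
      using n by (intro continuous_intros less.IH) auto
    have "continuous_on ({0..} \<times> {0..})
        (\<lambda>(t, s). K t s * (\<Sum>j\<in>{1..n-1}. hierarchy K f j s * hierarchy K f (n - j) s))"
      unfolding case_prod_beta
      by (intro continuous_on_mult continuous_on_compose2[OF S continuous_on_snd]
          continuous_on_subset[OF K[unfolded case_prod_beta]]) auto
    from volterra_integral_continuous[OF this]
    show ?thesis using hierarchy_ge_2[OF n, of K f] by (simp add: fun_eq_iff[symmetric] cong: continuous_on_cong)
  qed
qed

text \<open>Majorant principle. In the sum of products of the \<open>j\<close>-th and the \<open>(n - j)\<close>-th term, the induction
hypothesis contributes the factors \<open>\<sigma>\<^sup>j\<close> and \<open>\<sigma>\<^bsup>n-j\<^esup>\<close> in the denominators, whose product is \<open>\<sigma>\<^sup>n\<close>.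
Continuity of both hierarchies provides the integrability that monotonicity of the integral
requires.\<close>

lemma hierarchy_bound:
  fixes \<sigma> T :: real
  assumes K: "continuous_on UNIV (\<lambda>(t, s). K t s)"
    and f: "continuous_on {0..} f" and g: "continuous_on {0..} g" and "0 < \<sigma>"
    and le: "\<And>t. t \<in> {0..T} \<Longrightarrow> \<bar>f t\<bar> \<le> g t / \<sigma>"
    and "1 \<le> n" "t \<in> {0..T}"
  shows "\<bar>hierarchy K f n t\<bar> \<le> hierarchy (\<lambda>t s. \<bar>K t s\<bar>) g n t / \<sigma> ^ n"
  using \<open>1 \<le> n\<close> \<open>t \<in> {0..T}\<close>
proof (induction n arbitrary: t rule: less_induct)
  case (less n)
  let ?aK = "\<lambda>t s. \<bar>K t s\<bar>"
  show ?case
  proof (cases "n = 1")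
    case True
    then show ?thesis using le less.prems by (simp add: hierarchy_1)
  next
    case False
    then have n: "2 \<le> n" using less.prems by simp
    let ?h = "hierarchy K f" and ?g = "hierarchy ?aK g"
    let ?a = "\<lambda>s. K t s * (\<Sum>j\<in>{1..n-1}. ?h j s * ?h (n - j) s)"
    let ?b = "\<lambda>s. \<bar>K t s\<bar> * (\<Sum>j\<in>{1..n-1}. ?g j s * ?g (n - j) s)"
    have aK: "continuous_on UNIV (\<lambda>(t, s). ?aK t s)"
      using continuous_on_rabs[OF K] by (simp add: case_prod_beta)
    have Kt: "continuous_on A (K t)" for A
      using continuous_on_compose2[OF K, of A "\<lambda>s. (t, s)"] by (force intro: continuous_intros)
    have ch: "continuous_on {0..t} (?h j)" "continuous_on {0..t} (?g j)" if "1 \<le> j" for j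
      using hierarchy_continuous[OF K f that] hierarchy_continuous[OF aK g that]
      by (auto elim: continuous_on_subset)
    have ia: "set_integrable lborel {0..t} ?a"
      using n by (intro borel_integrable_atLeastAtMost' continuous_intros Kt ch) auto
    have ib: "set_integrable lborel {0..t} ?b"
      using n by (intro borel_integrable_atLeastAtMost' continuous_intros Kt ch) auto
    have t: "0 \<le> t" using less.prems by simp
    have ab: "norm (?a s) \<le> ?b s / \<sigma> ^ n" if s: "s \<in> {0..t}" for s
    proof -
      have "\<bar>?h j s * ?h (n - j) s\<bar> \<le> ?g j s * ?g (n - j) s / \<sigma> ^ n" if j: "j \<in> {1..n-1}" for j
      proof -
        have "\<bar>?h j s\<bar> * \<bar>?h (n - j) s\<bar> \<le> (?g j s / \<sigma> ^ j) * (?g (n - j) s / \<sigma> ^ (n - j))"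
          using j n s less.prems
          by (intro mult_mono less.IH order_trans[OF abs_ge_zero less.IH] abs_ge_zero) auto
        also have "\<dots> = ?g j s * ?g (n - j) s / \<sigma> ^ (j + (n - j))"
          by (simp add: power_add)
        also have "j + (n - j) = n" using j by auto
        finally show ?thesis by (simp add: abs_mult)
      qed
      then have "\<bar>\<Sum>j\<in>{1..n-1}. ?h j s * ?h (n - j) s\<bar> \<le> (\<Sum>j\<in>{1..n-1}. ?g j s * ?g (n - j) s / \<sigma> ^ n)"
        by (intro order_trans[OF sum_abs] sum_mono)
      also have "\<dots> = (\<Sum>j\<in>{1..n-1}. ?g j s * ?g (n - j) s) / \<sigma> ^ n"
        by (simp add: sum_divide_distrib)
      finally have "\<bar>K t s\<bar> * \<bar>\<Sum>j\<in>{1..n-1}. ?h j s * ?h (n - j) s\<bar>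
          \<le> \<bar>K t s\<bar> * ((\<Sum>j\<in>{1..n-1}. ?g j s * ?g (n - j) s) / \<sigma> ^ n)"
        by (intro mult_left_mono) auto
      then show ?thesis by (simp add: abs_mult)
    qed
    have "\<bar>?h n t\<bar> = norm (LBINT s:{0..t}. ?a s)"
      using t hierarchy_ge_2[OF n, of K f t] interval_integral_Icc[OF t, of ?a] by (simp add: zero_ereal_def)
    also have "\<dots> \<le> (LBINT s:{0..t}. norm (?a s))"
      by (rule set_integral_norm_bound[OF ia])
    also have "\<dots> \<le> (LBINT s:{0..t}. ?b s / \<sigma> ^ n)"
      by (intro set_integral_mono ab set_integrable_norm ia set_integrable_divide ib)
    also have "\<dots> = (LBINT s:{0..t}. ?b s) / \<sigma> ^ n"
      by (rule set_integral_divide_zero)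
    also have "(LBINT s:{0..t}. ?b s) = ?g n t"
      using t hierarchy_ge_2[OF n, of ?aK g t] interval_integral_Icc[OF t, of ?b] by (simp add: zero_ereal_def)
    finally show ?thesis .
  qed
qed

text \<open>A function that is continuous in one variable and measurable in the other is jointly measurable: it
is the limit of its discretisations \<open>Y (\<lfloor>k s\<rfloor> / k)\<close>, which take countably many values of the time.\<close>

lemma caratheodory_measurable:
  fixes Y :: "real \<Rightarrow> 'b \<Rightarrow> real"
  assumes Y: "\<And>s. Y s \<in> borel_measurable N"
    and cont: "\<And>\<omega>. \<omega> \<in> space N \<Longrightarrow> continuous_on UNIV (\<lambda>s. Y s \<omega>)"
  shows "(\<lambda>(\<omega>, s). Y s \<omega>) \<in> borel_measurable (N \<Otimes>\<^sub>M borel)"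
proof -
  \<comment> \<open>Rounding down to a multiple of \<open>1 / (k + 1)\<close>.\<close>
  define r where "r k s = real_of_int \<lfloor>real (Suc k) * s\<rfloor> / real (Suc k)" for k :: nat and s :: real
  have r: "(\<lambda>k. r k s) \<longlonglongrightarrow> s" for s
  proof (rule tendsto_sandwich)
    have "s - 1 / real (Suc k) = (real (Suc k) * s - 1) / real (Suc k)" for k
      by (simp add: diff_divide_distrib)
    moreover have "(real (Suc k) * s - 1) / real (Suc k) \<le> r k s" for k
      unfolding r_def by (intro divide_right_mono) linarith+
    ultimately show "\<forall>\<^sub>F k in sequentially. s - 1 / real (Suc k) \<le> r k s" by simp
    have "r k s \<le> real (Suc k) * s / real (Suc k)" for k
      unfolding r_def by (intro divide_right_mono) linarith+
    then show "\<forall>\<^sub>F k in sequentially. r k s \<le> s" by simp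
    show "(\<lambda>k. s - 1 / real (Suc k)) \<longlonglongrightarrow> s"
      using tendsto_diff[OF tendsto_const LIMSEQ_inverse_real_of_nat, of s] by (simp add: inverse_eq_divide)
  qed simp
  show ?thesis
  proof (rule borel_measurable_LIMSEQ_real)
    fix k :: nat
    have "(\<lambda>z. (\<lambda>i z. Y (real_of_int i / real (Suc k)) (fst z)) \<lfloor>real (Suc k) * snd z\<rfloor> z)
        \<in> borel_measurable (N \<Otimes>\<^sub>M borel)"
      by (rule measurable_compose_countable) (auto intro!: measurable_compose[OF measurable_fst Y])
    then show "(\<lambda>(\<omega>, s). Y (r k s) \<omega>) \<in> borel_measurable (N \<Otimes>\<^sub>M borel)"
      by (simp add: r_def case_prod_beta)
  next
    fix z assume "z \<in> space (N \<Otimes>\<^sub>M (borel :: real measure))"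
    then have "continuous_on UNIV (\<lambda>s. Y s (fst z))" by (intro cont) (auto simp: space_pair_measure)
    then have "isCont (\<lambda>s. Y s (fst z)) (snd z)" by (simp add: continuous_on_eq_continuous_at)
    from isCont_tendsto_compose[OF this r]
    show "(\<lambda>k. (\<lambda>(\<omega>, s). Y (r k s) \<omega>) z) \<longlonglongrightarrow> (\<lambda>(\<omega>, s). Y s \<omega>) z" by (simp add: case_prod_beta)
  qed
qed

lemma pathwise_integral_measurable:
  fixes Y :: "real \<Rightarrow> 'b \<Rightarrow> real"
  assumes Y: "\<And>s. 0 \<le> s \<Longrightarrow> Y s \<in> borel_measurable N"
    and cont: "\<And>\<omega>. \<omega> \<in> space N \<Longrightarrow> continuous_on {0..} (\<lambda>s. Y s \<omega>)" and t: "0 \<le> t"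
  shows "(\<lambda>\<omega>. LBINT s=0..ereal t. Y s \<omega>) \<in> borel_measurable N"
proof -
  \<comment> \<open>Extending the paths by their initial value makes them continuous on the whole line.\<close>
  have "(\<lambda>(\<omega>, s). Y (max 0 s) \<omega>) \<in> borel_measurable (N \<Otimes>\<^sub>M borel)"
    by (rule caratheodory_measurable)
       (auto intro!: Y continuous_on_compose2[OF cont] continuous_intros)
  then have [measurable]: "(\<lambda>(\<omega>, s). Y (max 0 s) \<omega>) \<in> borel_measurable (N \<Otimes>\<^sub>M lborel)"
    by (simp cong: measurable_cong_sets sets_pair_measure_cong)
  have "(\<lambda>\<omega>. \<integral>s. indicator {0..t} s * Y (max 0 s) \<omega> \<partial>lborel) \<in> borel_measurable N"
    by measurable
  moreover have "(LBINT s=0..ereal t. Y s \<omega>) = (\<integral>s. indicator {0..t} s * Y (max 0 s) \<omega> \<partial>lborel)" for \<omega>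
    using interval_integral_Icc[OF t, of "\<lambda>s. Y s \<omega>"]
    by (auto simp: zero_ereal_def set_lebesgue_integral_def indicator_def
        intro!: Bochner_Integration.integral_cong)
  ultimately show ?thesis by simp
qed

lemma hierarchy_measurable:
  fixes X :: "real \<Rightarrow> 'b \<Rightarrow> real"
  assumes K: "continuous_on UNIV (\<lambda>(t, s). K t s)"
    and X: "\<And>s. 0 \<le> s \<Longrightarrow> X s \<in> borel_measurable N"
    and cont: "\<And>\<omega>. \<omega> \<in> space N \<Longrightarrow> continuous_on {0..} (\<lambda>s. X s \<omega>)"
    and "1 \<le> n" "0 \<le> t"
  shows "(\<lambda>\<omega>. hierarchy K (\<lambda>s. X s \<omega>) n t) \<in> borel_measurable N"
  using \<open>1 \<le> n\<close> \<open>0 \<le> t\<close>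
proof (induction n arbitrary: t rule: less_induct)
  case (less n)
  show ?case
  proof (cases "n = 1")
    case True
    then show ?thesis using X less.prems by (simp add: hierarchy_1)
  next
    case False
    then have n: "2 \<le> n" using less.prems by simp
    have Kt: "continuous_on A (K t)" for A
      using continuous_on_compose2[OF K, of A "\<lambda>s. (t, s)"] by (force intro: continuous_intros)
    show ?thesis
      unfolding hierarchy_ge_2[OF n]
      using n less.prems
      by (intro pathwise_integral_measurable borel_measurable_times borel_measurable_sum less.IH
          borel_measurable_const continuous_intros Kt hierarchy_continuous[OF K cont]) auto
  qed
qed

text \<open>The paths are replaced by zero on a null set, so that all of them are continuous. For the modified
paths it suffices to test the inequality at rational times, and the event is a countable
intersection of measurable sets. The original event differs from it by a subset of a null set,
which completeness makes measurable.\<close>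

lemma hierarchy_bound_event_measurable:
  fixes X :: "real \<Rightarrow> 'b \<Rightarrow> real" and g :: "real \<Rightarrow> real"
  assumes "complete_measure M"
    and K: "continuous_on UNIV (\<lambda>(t, s). K t s)"
    and X: "\<And>s. 0 \<le> s \<Longrightarrow> X s \<in> borel_measurable M"
    and cont: "AE \<omega> in M. continuous_on {0..} (\<lambda>s. X s \<omega>)"
    and g: "continuous_on {0..} g" and "0 < T" "1 \<le> n"
  shows "{\<omega> \<in> space M. \<forall>t\<in>{0..T}. \<bar>hierarchy K (\<lambda>s. X s \<omega>) n t\<bar> \<le> g t} \<in> sets M"
proof -
  interpret complete_measure M by fact
  obtain N where N: "N \<in> null_sets M"
    and cX: "\<And>\<omega>. \<omega> \<in> space M - N \<Longrightarrow> continuous_on {0..} (\<lambda>s. X s \<omega>)"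
    using AE_E3[OF cont] by blast
  define Y where "Y s \<omega> = (if \<omega> \<in> N then 0 else X s \<omega>)" for s \<omega>
  have Y: "Y s \<in> borel_measurable M" if "0 \<le> s" for s
    unfolding Y_def[abs_def] using N X[OF that] by (intro measurable_If_set) auto
  have cY: "continuous_on {0..} (\<lambda>s. Y s \<omega>)" if "\<omega> \<in> space M" for \<omega>
    using cX that by (cases "\<omega> \<in> N") (auto simp: Y_def)
  let ?h = "\<lambda>t \<omega>. hierarchy K (\<lambda>s. Y s \<omega>) n t"
  define E where "E = space M - {\<omega> \<in> space M. \<exists>t\<in>\<rat> \<inter> {0..T}. g t < \<bar>?h t \<omega>\<bar>}"
  have hm: "?h t \<in> borel_measurable M" if "0 \<le> t" for t
    by (rule hierarchy_measurable[OF K Y cY \<open>1 \<le> n\<close> that])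
  have "{\<omega> \<in> space M. \<exists>t\<in>\<rat> \<inter> {0..T}. g t < \<bar>?h t \<omega>\<bar>} \<in> sets M"
    by (intro sets_exceeds countable_Int1 countable_rat) (auto intro: hm)
  then have E: "E \<in> sets M" unfolding E_def by auto
  show ?thesis
  proof (rule in_sets_AE[OF _ E])
    show "AE \<omega> in M. (\<omega> \<in> E) = (\<omega> \<in> {\<omega> \<in> space M. \<forall>t\<in>{0..T}. \<bar>hierarchy K (\<lambda>s. X s \<omega>) n t\<bar> \<le> g t})"
      using AE_not_in[OF N] AE_space
    proof eventually_elim
      case (elim \<omega>)
      have XY: "hierarchy K (\<lambda>s. X s \<omega>) n t = ?h t \<omega>" for t using elim by (simp add: Y_def)
      have "\<bar>?h t \<omega>\<bar> - g t \<le> 0" if "\<omega> \<in> E" "t \<in> {0..T}" for t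
      proof (rule continuous_le_from_rationals[OF \<open>0 < T\<close> _ _ that(2)])
        show "continuous_on {0..T} (\<lambda>t. \<bar>?h t \<omega>\<bar> - g t)"
          using elim
          by (intro continuous_intros continuous_on_subset[OF hierarchy_continuous[OF K cY \<open>1 \<le> n\<close>]]
              continuous_on_subset[OF g]) auto
        show "\<bar>?h t \<omega>\<bar> - g t \<le> 0" if "t \<in> \<rat> \<inter> {0..T}" for t
          using that \<open>\<omega> \<in> E\<close> by (force simp: E_def not_less)
      qed
      then show ?case using elim by (auto simp: XY E_def not_less)
    qed
  qed auto
qed

section \<open>The probability estimate\<close>

text \<open>The maximal inequality at the level \<open>1/\<sigma>\<close>. The exceptional set is described by rational times to make
it measurable; outside of it a continuous path stays below the level at all times.\<close>

lemma (in brownian_motion) wiener_integral_exceedance: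
  assumes I: "wiener_integral_process M B f I" and "0 < T" and "0 < \<sigma>"
  defines "Bad \<equiv> {\<omega> \<in> space M. \<exists>t\<in>\<rat> \<inter> {0..T}. 1 / \<sigma> < \<bar>I t \<omega>\<bar>}"
  shows "Bad \<in> sets M" and "prob Bad \<le> \<sigma> * sqrt (2 / pi) * L2_norm_on T f"
    and "\<And>\<omega> t. \<omega> \<in> space M - Bad \<Longrightarrow> continuous_on {0..} (\<lambda>t. I t \<omega>) \<Longrightarrow> t \<in> {0..T} \<Longrightarrow> \<bar>I t \<omega>\<bar> \<le> 1 / \<sigma>"
proof -
  have W: "is_wiener_integral M B f t (I t)" if "0 \<le> t" for t
    using I that by (simp add: wiener_integral_process_def)
  have "I t \<in> borel_measurable M" if "0 \<le> t" for t
    using W[OF that] by (auto simp: is_wiener_integral_def L2_tendsto_def)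
  then show "Bad \<in> sets M"
    unfolding Bad_def by (intro sets_exceeds countable_Int1 countable_rat) auto
  have "L2_norm_on T f = sqrt (\<integral>s. (f s)\<^sup>2 \<partial>lborel_upto T)"
    using interval_integral_Icc[of 0 T "\<lambda>s. (f s)\<^sup>2"] \<open>0 < T\<close>
    by (simp add: L2_norm_on_def zero_ereal_def set_lebesgue_integral_def integral_upto_eq)
  then have "1 / \<sigma> * prob Bad \<le> sqrt (2 / pi) * L2_norm_on T f"
    using wiener_integral_maximal_inequality[OF W \<open>0 < T\<close>, of "1 / \<sigma>"] \<open>0 < \<sigma>\<close> by (simp add: Bad_def)
  then show "prob Bad \<le> \<sigma> * sqrt (2 / pi) * L2_norm_on T f"
    using \<open>0 < \<sigma>\<close> by (simp add: field_simps)
  show "\<bar>I t \<omega>\<bar> \<le> 1 / \<sigma>"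
    if "\<omega> \<in> space M - Bad" "continuous_on {0..} (\<lambda>t. I t \<omega>)" "t \<in> {0..T}" for \<omega> t
  proof (rule continuous_le_from_rationals[OF \<open>0 < T\<close> _ _ that(3)])
    show "continuous_on {0..T} (\<lambda>t. \<bar>I t \<omega>\<bar>)"
      by (intro continuous_intros continuous_on_subset[OF that(2)]) auto
    show "\<bar>I t \<omega>\<bar> \<le> 1 / \<sigma>" if "t \<in> \<rat> \<inter> {0..T}" for t
      using that \<open>\<omega> \<in> space M - Bad\<close> by (force simp: Bad_def not_less)
  qed
qed

theorem proposition3p1:
  fixes M :: "'a measure" and B :: "real \<Rightarrow> 'a \<Rightarrow> real"
    and a c y \<kappa>1 \<kappa>2 \<sigma> T :: real
    and w1 w2 :: "real \<Rightarrow> real" and K :: "real \<Rightarrow> real \<Rightarrow> real"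
    and I1 I2 :: "real \<Rightarrow> 'a \<Rightarrow> real"
    and x :: "nat \<Rightarrow> real \<Rightarrow> 'a \<Rightarrow> real" and \<gamma> :: "nat \<Rightarrow> real \<Rightarrow> real"
    and n :: nat
  assumes "complete_measure M" and "std_brownian_motion M B"
    and "c < 0" and "0 < a" and "2 * c + a < 0" and "c < - a - c" and "- a - c < a"
    and "y \<in> {c..- a - c}"
    and "\<sigma> > 0"
    and "\<kappa>1 \<noteq> 0" and "\<kappa>2 \<noteq> 0"
    and "w1 = w_sol a c y \<kappa>1 u1" and "w2 = w_sol a c y \<kappa>2 u2"
    and "\<forall>t\<ge>0. w1 t * deriv w2 t - deriv w1 t * w2 t = 1"
    and "K = (\<lambda>t s. w2 t * w1 s - w1 t * w2 s)"
    and "wiener_integral_process M B w1 I1" and "wiener_integral_process M B w2 I2"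
    and "x = (\<lambda>m t \<omega>. hierarchy K (\<lambda>s. w2 s * I1 s \<omega> - w1 s * I2 s \<omega>) m t)"
    and "\<gamma> = hierarchy (\<lambda>t s. \<bar>K t s\<bar>) (\<lambda>t. \<bar>w1 t\<bar> + \<bar>w2 t\<bar>)"
    and "T > 0" and "n \<ge> 1"
  shows "measure M {\<omega> \<in> space M. \<forall>t\<in>{0..T}. \<bar>x n t \<omega>\<bar> \<le> \<gamma> n t / \<sigma> ^ n}
           \<ge> 1 - \<sigma> * 2 ^ (n - 2) * sqrt (2 / pi) * (L2_norm_on T w1 + L2_norm_on T w2)"
proof -
  interpret brownian_motion M B
    using assms(2) by (auto simp: brownian_motion_def brownian_motion_axioms_def std_brownian_motion_def)
  have q: "(ell_modulus a c)\<^sup>2 < 1" using assms by (intro ell_modulus_less_1) auto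
  have w1: "continuous_on A w1" and w2: "continuous_on A w2" for A
    unfolding assms(12,13)
    by (rule continuous_on_subset[OF continuous_on_w_sol subset_UNIV],
        rule continuous_on_u1[OF q] continuous_on_u2[OF q])+
  have K: "continuous_on UNIV (\<lambda>(t, s). K t s)"
    unfolding assms(15) case_prod_beta
    by (intro continuous_intros continuous_on_compose2[OF w1[of UNIV]] continuous_on_compose2[OF w2[of UNIV]]) auto
  have aK: "continuous_on UNIV (\<lambda>(t, s). \<bar>K t s\<bar>)"
    using continuous_on_rabs[OF K] by (simp add: case_prod_beta)
  have g: "continuous_on {0..} (\<lambda>t. \<bar>w1 t\<bar> + \<bar>w2 t\<bar>)" by (intro continuous_intros w1 w2)
  have \<gamma>: "continuous_on {0..} (\<gamma> n)"
    unfolding assms(19) by (rule hierarchy_continuous[OF aK g assms(21)])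
  have Im: "I1 t \<in> borel_measurable M" "I2 t \<in> borel_measurable M" if "0 \<le> t" for t
    using assms(16,17) that by (auto simp: wiener_integral_process_def is_wiener_integral_def L2_tendsto_def)
  have Ic: "AE \<omega> in M. continuous_on {0..} (\<lambda>t. I1 t \<omega>) \<and> continuous_on {0..} (\<lambda>t. I2 t \<omega>)"
    using assms(16,17) by (auto simp: wiener_integral_process_def)
  let ?X = "\<lambda>s \<omega>. w2 s * I1 s \<omega> - w1 s * I2 s \<omega>"
  let ?E = "{\<omega> \<in> space M. \<forall>t\<in>{0..T}. \<bar>x n t \<omega>\<bar> \<le> \<gamma> n t / \<sigma> ^ n}"
  have E: "?E \<in> sets M"
    unfolding assms(18)
  proof (rule hierarchy_bound_event_measurable[OF assms(1) K])
    show "AE \<omega> in M. continuous_on {0..} (\<lambda>s. ?X s \<omega>)"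
      using Ic by eventually_elim (auto intro!: continuous_intros w1 w2)
  qed (use Im assms \<gamma> in \<open>auto intro!: continuous_intros\<close>)
  obtain N where N: "N \<in> null_sets M" and
    cI: "\<And>\<omega>. \<omega> \<in> space M - N \<Longrightarrow> continuous_on {0..} (\<lambda>t. I1 t \<omega>) \<and> continuous_on {0..} (\<lambda>t. I2 t \<omega>)"
    using AE_E3[OF Ic] by blast
  let ?Bad = "\<lambda>I. {\<omega> \<in> space M. \<exists>t\<in>\<rat> \<inter> {0..T}. 1 / \<sigma> < \<bar>I t \<omega>\<bar>}"
  note bad1 = wiener_integral_exceedance[OF assms(16,20,9)]
  note bad2 = wiener_integral_exceedance[OF assms(17,20,9)]
  let ?C = "?Bad I1 \<union> ?Bad I2 \<union> N"
  have "space M - ?C \<subseteq> ?E"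
  proof
    fix \<omega> assume "\<omega> \<in> space M - ?C"
    then have \<omega>: "\<omega> \<in> space M" "\<omega> \<notin> ?Bad I1" "\<omega> \<notin> ?Bad I2" "\<omega> \<notin> N" by blast+
    have c: "continuous_on {0..} (\<lambda>t. I1 t \<omega>)" "continuous_on {0..} (\<lambda>t. I2 t \<omega>)"
      using cI[of \<omega>] \<omega> by auto
    have "\<bar>?X s \<omega>\<bar> \<le> (\<bar>w1 s\<bar> + \<bar>w2 s\<bar>) / \<sigma>" if "s \<in> {0..T}" for s
    proof -
      have "\<bar>?X s \<omega>\<bar> \<le> \<bar>w2 s\<bar> * \<bar>I1 s \<omega>\<bar> + \<bar>w1 s\<bar> * \<bar>I2 s \<omega>\<bar>"
        using abs_triangle_ineq4[of "w2 s * I1 s \<omega>" "w1 s * I2 s \<omega>"] by (simp add: abs_mult)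
      also have "\<dots> \<le> \<bar>w2 s\<bar> * (1 / \<sigma>) + \<bar>w1 s\<bar> * (1 / \<sigma>)"
        using \<omega> bad1(3)[OF _ c(1) that] bad2(3)[OF _ c(2) that]
        by (intro add_mono mult_left_mono) auto
      finally show ?thesis by (simp add: add_divide_distrib)
    qed
    then have "\<bar>x n t \<omega>\<bar> \<le> \<gamma> n t / \<sigma> ^ n" if "t \<in> {0..T}" for t
      unfolding assms(18,19) using c that assms(9,21)
      by (intro hierarchy_bound[OF K _ g]) (auto intro!: continuous_intros w1 w2)
    then show "\<omega> \<in> ?E" using \<omega>(1) by blast
  qed
  then have "prob (space M - ?C) \<le> prob ?E" by (rule finite_measure_mono[OF _ E])
  moreover have "prob (space M - ?C) = 1 - prob ?C"
    using bad1(1) bad2(1) N by (intro prob_compl) auto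
  moreover have "prob ?C \<le> prob (?Bad I1) + prob (?Bad I2) + prob N"
    using bad1(1) bad2(1) N measure_Un_le[of "?Bad I1 \<union> ?Bad I2" M N] measure_Un_le[of "?Bad I1" M "?Bad I2"]
    by force
  moreover have "prob N = 0" using N by (simp add: measure_eq_0_null_sets)
  ultimately have "1 - \<sigma> * sqrt (2 / pi) * (L2_norm_on T w1 + L2_norm_on T w2) \<le> prob ?E"
    using bad1(2) bad2(2) by (simp add: distrib_left)
  \<comment> \<open>The factor \<open>2 ^ (n - 2)\<close> is at least \<open>1\<close>, with the truncated subtraction of natural numbers for \<open>(n - 2)\<^sup>+\<close>.\<close>
  moreover have "\<sigma> * sqrt (2 / pi) * (L2_norm_on T w1 + L2_norm_on T w2) * 1
      \<le> \<sigma> * sqrt (2 / pi) * (L2_norm_on T w1 + L2_norm_on T w2) * 2 ^ (n - 2)"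
  proof (rule mult_left_mono)
    have "0 \<le> \<sigma> * sqrt (2 / pi) * L2_norm_on T w1" "0 \<le> \<sigma> * sqrt (2 / pi) * L2_norm_on T w2"
      using bad1(2) bad2(2) by (meson measure_nonneg order_trans)+
    then show "0 \<le> \<sigma> * sqrt (2 / pi) * (L2_norm_on T w1 + L2_norm_on T w2)" by (simp add: distrib_left)
  qed simp
  ultimately show ?thesis by (simp add: mult_ac)
qed

end
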